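(* Let $\Omega\subseteq\mathbb{R}^N$ be a coercive epigraph, and let $u\in\mathcal{L}_s(\mathbb{R}^N)\cap C^{1,1}_{loc}(\Omega)\cap C(\overline\Omega)$ be a solution of $$\begin{cases}(-\Delta+m^2)^s u=f(x,u) & \text{in }\Omega,\\ u>0 & \text{in }\Omega,\\ u=0 & \text{in }\mathbb{R}^N\setminus\Omega,\end{cases}$$ where $f(x,t)$ is continuous in $\overline\Omega\times\mathbb{R}$, non-decreasing in $x_N$, and locally Lipschitz continuous in $t$, locally uniformly in $x$, in the following sense: for any $M>0$ and any compact set $K\subset\overline\Omega$ there exists $C>0$ depending on $M$ and $K$ such that $$\sup_{x\in K}\frac{|f(x,t)-f(x,\tau)|}{|t-\tau|}\le C\qquad\text{for all } t,\tau\in[-M,M],\ t\ne\tau.$$ Then $u$ is strictly monotone increasing in $x_N$ (in $\Omega$).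
   Context: Let $N\ge 1$ be an integer, $0<s<1$, $m>0$. Points are written $x=(x',x_N)$ with $x'\in\mathbb{R}^{N-1}$. A domain $\Omega\subseteq\mathbb{R}^N$ is a coercive epigraph if there is a continuous $\varphi:\mathbb{R}^{N-1}\to\mathbb{R}$ with $\lim_{|x'|\to+\infty}\varphi(x')=+\infty$ such that $\Omega=\{x=(x',x_N)\in\mathbb{R}^N: x_N>\varphi(x')\}$. $K_\nu$ is the modified Bessel function of the second kind of order $\nu$, $K_\nu(r)=\int_0^\infty e^{-r\cosh t}\cosh(\nu t)\,dt$ for $r>0$. The operator is $$(-\Delta+m^2)^s u(x)=c_{N,s}m^{\frac N2+s}\,\mathrm{P.V.}\int_{\mathbb{R}^N}\frac{u(x)-u(y)}{|x-y|^{\frac N2+s}}K_{\frac N2+s}(m|x-y|)\,dy+m^{2s}u(x),\qquad c_{N,s}=2^{1-\frac N2+s}\pi^{-\frac N2}\frac{s(1-s)}{\Gamma(2-s)},$$ where P.V. denotes the Cauchy principal value. The function space is $\mathcal{L}_s(\mathbb{R}^N)=\{u:\mathbb{R}^N\to\mathbb{R}\,:\,\int_{\mathbb{R}^N}\frac{e^{-|x|}|u(x)|}{1+|x|^{\frac{N+1}2+s}}dx<\infty\}$. $C^{1,1}_{loc}$ denotes $C^1$ functions with locally Lipschitz gradient. Convention: whenever the operator is applied to a function $u$, it is understood that $\int_{|y-x|\ge1}\frac{|u(y)|}{|x-y|^{N/2+s}}K_{\frac N2+s}(m|x-y|)\,dy<\infty$ for every $x\in\mathbb{R}^N$, so that $(-\Delta+m^2)^su$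 is well defined where $u$ is locally $C^{1,1}$ (this is automatic for $u\in\mathcal{L}_s(\mathbb{R}^N)$ if $m\ge1$). *)

theory Defs
  imports "HOL-Analysis.Analysis"
begin

text \<open>
  Points of \<open>\<real>\<^sup>N\<close>, \<open>N \<ge> 1\<close>, are vectors of type \<open>real ^ 'n\<close> with \<open>N = CARD('n)\<close>. An index
  \<open>k :: 'n\<close> is singled out as the last coordinate, so \<open>x\<^sub>N\<close> is \<open>x $ k\<close>. The space \<open>\<real>\<^sup>N\<^sup>-\<^sup>1\<close> is
  represented by the coordinate hyperplane \<open>{y. y $ k = 0}\<close>; a type \<open>real ^ 'm\<close> would exclude
  \<open>N = 1\<close>, where the hyperplane is \<open>{0}\<close>.
\<close>

definition horiz_space :: "'n::finite \<Rightarrow> (real ^ 'n) set" where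
  "horiz_space k = {y. y $ k = 0}"

definition horiz :: "'n::finite \<Rightarrow> real ^ 'n \<Rightarrow> real ^ 'n" where
  "horiz k x = (\<chi> j. if j = k then 0 else x $ j)"

text \<open>
  Only the values of \<open>\<phi>\<close> on the hyperplane matter. For \<open>N = 1\<close> the filter below is trivial and the
  coercivity condition is void. An epigraph of a continuous function is open and connected.
\<close>

definition coercive_epigraph :: "'n::finite \<Rightarrow> (real ^ 'n) set \<Rightarrow> bool" where
  "coercive_epigraph k \<Omega> \<longleftrightarrow>
     (\<exists>\<phi> :: real ^ 'n \<Rightarrow> real.
        continuous_on (horiz_space k) \<phi> \<and>
        filterlim \<phi> at_top (inf at_infinity (principal (horiz_space k))) \<and>
        \<Omega> = {x. x $ k > \<phi> (horiz k x)})"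

definition bessel_K :: "real \<Rightarrow> real \<Rightarrow> real" where
  "bessel_K \<nu> r = (LINT t:{0..}|lborel. exp (- r * cosh t) * cosh (\<nu> * t))"

definition c_const :: "nat \<Rightarrow> real \<Rightarrow> real" where
  "c_const N s =
     2 powr (1 - real N / 2 + s) * pi powr (- (real N / 2)) * (s * (1 - s) / Gamma (2 - s))"

definition pv_integral :: "('a::euclidean_space \<Rightarrow> real) \<Rightarrow> 'a \<Rightarrow> real" where
  "pv_integral g x = Lim (at_right 0) (\<lambda>\<epsilon>. LINT y:- ball x \<epsilon>|lebesgue. g y)"

text \<open>\<open>rel_frac_op m s u x\<close> is \<open>(-\<Delta> + m\<^sup>2)\<^sup>s u(x)\<close>.\<close>

definition rel_frac_op ::
    "real \<Rightarrow> real \<Rightarrow> (real ^ 'n::finite \<Rightarrow> real) \<Rightarrow> real ^ 'n \<Rightarrow> real" where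
  "rel_frac_op m s u x =
     (let N = CARD('n); \<nu> = real N / 2 + s in
        c_const N s * m powr \<nu> *
          pv_integral
            (\<lambda>y. (u x - u y) / norm (x - y) powr \<nu> * bessel_K \<nu> (m * norm (x - y))) x
        + m powr (2 * s) * u x)"

text \<open>
  The convention under which \<open>rel_frac_op m s u\<close> is applied to \<open>u\<close>; together with local
  integrability it makes the principal value converge wherever \<open>u\<close> is locally \<open>C\<^sup>1\<^sup>,\<^sup>1\<close>.
\<close>

definition tail_integrable ::
    "real \<Rightarrow> real \<Rightarrow> (real ^ 'n::finite \<Rightarrow> real) \<Rightarrow> bool" where
  "tail_integrable m s u \<longleftrightarrow>
     (let \<nu> = real CARD('n) / 2 + s in
        \<forall>x. set_integrable lebesgue {y. norm (y - x) \<ge> 1}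
              (\<lambda>y. \<bar>u y\<bar> / norm (x - y) powr \<nu> * bessel_K \<nu> (m * norm (x - y))))"

definition L_space :: "real \<Rightarrow> (real ^ 'n::finite \<Rightarrow> real) set" where
  "L_space s =
     {u. u \<in> borel_measurable lebesgue \<and>
         integrable lebesgue
           (\<lambda>x. exp (- norm x) * \<bar>u x\<bar> / (1 + norm x powr ((real CARD('n) + 1) / 2 + s)))}"

text \<open>Continuity of the gradient \<open>g\<close> follows from its local Lipschitz continuity.\<close>

definition C11_loc :: "'a::euclidean_space set \<Rightarrow> ('a \<Rightarrow> real) set" where
  "C11_loc \<Omega> =
     {u. \<exists>g. (\<forall>x\<in>\<Omega>. GDERIV u x :> g x) \<and>
             (\<forall>x\<in>\<Omega>. \<exists>r>0. \<exists>L. L-lipschitz_on (ball x r \<inter> \<Omega>) g)}"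

definition nondecreasing_in_xN ::
    "'n::finite \<Rightarrow> (real ^ 'n) set \<Rightarrow> (real ^ 'n \<Rightarrow> real) \<Rightarrow> bool" where
  "nondecreasing_in_xN k S h \<longleftrightarrow>
     (\<forall>x\<in>S. \<forall>y\<in>S. horiz k x = horiz k y \<and> x $ k \<le> y $ k \<longrightarrow> h x \<le> h y)"

definition strictly_increasing_in_xN ::
    "'n::finite \<Rightarrow> (real ^ 'n) set \<Rightarrow> (real ^ 'n \<Rightarrow> real) \<Rightarrow> bool" where
  "strictly_increasing_in_xN k S h \<longleftrightarrow>
     (\<forall>x\<in>S. \<forall>y\<in>S. horiz k x = horiz k y \<and> x $ k < y $ k \<longrightarrow> h x < h y)"

definition loc_lipschitz_in_t ::
    "'a::euclidean_space set \<Rightarrow> ('a \<Rightarrow> real \<Rightarrow> real) \<Rightarrow> bool" where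
  "loc_lipschitz_in_t S f \<longleftrightarrow>
     (\<forall>M>0. \<forall>K. compact K \<and> K \<subseteq> S \<longrightarrow>
        (\<exists>C>0. \<forall>t\<in>{-M..M}. \<forall>\<tau>\<in>{-M..M}. t \<noteq> \<tau> \<longrightarrow>
           (\<forall>x\<in>K. \<bar>f x t - f x \<tau>\<bar> / \<bar>t - \<tau>\<bar> \<le> C)))"

end

theory Submission
  imports Defs
begin

text \<open>
  The proof is the method of moving planes for a nonlocal operator with a radially decreasing kernel.
  Write \<open>w\<close> for the difference \<open>u (mirror k l x) - u x\<close>, where \<open>mirror k l\<close> is the
  reflection in the plane \<open>x $ k = l\<close>. The claim is that \<open>w\<close> is positive at every point of
  \<open>\<Omega>\<close> below the plane, for every \<open>l\<close>.

  Below the plane \<open>w\<close> is nonnegative outside \<open>\<Omega>\<close>, and in \<open>\<Omega>\<close> the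
  monotonicity of \<open>f\<close> in the last variable and its Lipschitz continuity give a linear inequality
  between \<open>w\<close> and the operator applied to it. Because \<open>w\<close> is antisymmetric, the nonlocal
  term at a nonpositive minimum can be folded onto one half-space (\<open>mirror_comparison\<close>), where it
  has a sign: the kernel decreases and the mirror image of a point is farther away than the point. This
  yields two facts. A negative minimum cannot lie too close to the plane, since the non-integrable
  singularity of the kernel
  then produces an arbitrarily large multiple of the minimum value (\<open>mirror_narrow_region\<close>). And a
  nonnegative \<open>w\<close> cannot vanish at a point of \<open>\<Omega>\<close> below the plane
  (\<open>mirror_strong_maximum\<close>).

  Coercivity makes the part of \<open>\<Omega>\<close> below each plane bounded, which supplies minimum points,
  uniform Lipschitz constants and limits. The first plane at which positivity could fail is then ruled out
  by a compactness argument (\<open>moving_planes\<close>). The narrow region principle is uniform in the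
  plane, so it starts the procedure and also excludes that minimum points accumulate on the critical plane.

  For the kernel \<open>K\<^sub>\<nu> (m r) / r powr \<nu>\<close> with \<open>\<nu> = N / 2 + s\<close> one needs strict
  monotonicity, the integrability of \<open>min 1 r\<^sup>2\<close> against it, which together with the
  \<open>C\<^sup>1\<^sup>,\<^sup>1\<close> regularity makes the principal value exist, and a lower bound at the
  origin. All of them follow from the integral representation of \<open>K\<^sub>\<nu>\<close>.
\<close>

section \<open>Reflections and Lebesgue measure\<close>

lemma integral_measure_preserving:
  fixes f :: "'a::euclidean_space \<Rightarrow> real"
  assumes "distr lborel borel T = lborel" "T \<in> borel_measurable borel" "f \<in> borel_measurable borel"
  shows "integrable lborel (\<lambda>x. f (T x)) \<longleftrightarrow> integrable lborel f"
    and "(LINT x|lborel. f (T x)) = (LINT x|lborel. f x)"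
proof -
  have T: "T \<in> measurable lborel borel" using assms(2) by simp
  show "integrable lborel (\<lambda>x. f (T x)) \<longleftrightarrow> integrable lborel f"
    using integrable_distr_eq[OF T, of f] assms by simp
  show "(LINT x|lborel. f (T x)) = (LINT x|lborel. f x)"
    using integral_distr[OF T, of f] assms by simp
qed

lemma distr_lborel_translation_sign:
  fixes t :: "'a::euclidean_space"
  assumes "\<bar>c\<bar> = 1"
  shows "distr lborel borel (\<lambda>z. t + c *\<^sub>R z) = (lborel :: 'a measure)"
  using lborel_affine[of c t] assms by (auto simp: density_1)

definition mirror :: "'n::finite \<Rightarrow> real \<Rightarrow> real ^ 'n \<Rightarrow> real ^ 'n" where
  "mirror k l x = x + (2 * (l - x $ k)) *\<^sub>R axis k 1"

lemma mirror_nth: "mirror k l x $ j = (if j = k then 2 * l - x $ k else x $ j)"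
  by (simp add: mirror_def axis_def)

lemma mirror_mirror [simp]: "mirror k l (mirror k l x) = x"
  by (simp add: vec_eq_iff mirror_nth)

lemma continuous_on_mirror [continuous_intros]:
  "continuous_on S f \<Longrightarrow> continuous_on S g \<Longrightarrow> continuous_on S (\<lambda>x. mirror k (f x) (g x))"
  unfolding mirror_def by (intro continuous_intros)

lemma mirror_measurable [measurable]: "mirror k l \<in> borel_measurable borel"
  by (intro borel_measurable_continuous_onI continuous_intros)

lemma distr_lborel_mirror: "distr lborel borel (mirror (k::'n::finite) l) = lborel"
proof -
  \<comment> \<open>A reflection is a diagonal map with entries 1 and a single entry -1, followed by a translation.\<close>
  define c where "c j = (if j = axis k 1 then - 1 else 1 :: real)" for j :: "real ^ 'n"
  have c: "\<And>j. \<bar>c j\<bar> = 1" "\<And>j. c j \<noteq> 0" by (auto simp: c_def)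
  have e: "mirror k l x = (2 * l) *\<^sub>R axis k 1 + (\<Sum>j\<in>Basis. (c j * (x \<bullet> j)) *\<^sub>R j)" for x
  proof -
    have "(\<Sum>j\<in>Basis. (c j * (x \<bullet> j)) *\<^sub>R j)
        = (\<Sum>j\<in>Basis. (x \<bullet> j) *\<^sub>R j - (if j = axis k 1 then (2 * (x \<bullet> j)) *\<^sub>R j else 0))"
      by (intro sum.cong) (auto simp: c_def scaleR_2[symmetric] scaleR_left_distrib[symmetric] algebra_simps)
    also have "\<dots> = x - (2 * x $ k) *\<^sub>R axis k 1"
      by (simp add: sum_subtractf euclidean_representation sum.delta inner_axis axis_in_Basis_iff)
    finally show ?thesis by (simp add: mirror_def algebra_simps)
  qed
  have "lborel = density (distr lborel borel (mirror k l)) (\<lambda>_. (\<Prod>j\<in>Basis. \<bar>c j\<bar>))"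
    using lborel_affine_euclidean[where t = "(2 * l) *\<^sub>R axis k 1" and c = c, OF c(2)]
    unfolding e[symmetric] by (simp add: fun_eq_iff)
  then show ?thesis by (simp add: c density_1)
qed

text \<open>
  The whole comparison of the two half-spaces rests on this identity: for two points on the same
  side of the plane, reflecting one of them strictly increases the distance.
\<close>

lemma norm_diff_mirror:
  fixes x y :: "real ^ 'n::finite"
  shows "norm (x - mirror k l y) ^ 2 = norm (x - y) ^ 2 + 4 * (l - x $ k) * (l - y $ k)"
proof -
  have "norm (x - mirror k l y) ^ 2 = norm ((x - y) - (2 * (l - y $ k)) *\<^sub>R axis k 1) ^ 2"
    by (simp add: mirror_def algebra_simps)
  also have "\<dots> = norm (x - y) ^ 2 + 4 * (l - x $ k) * (l - y $ k)"
    unfolding power2_norm_eq_inner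
    by (simp add: inner_diff_left inner_diff_right inner_axis inner_commute[of "axis k 1"])
       (simp add: algebra_simps power2_eq_square)
  finally show ?thesis .
qed

lemma norm_mirror_diff_mirror: "norm (mirror k l x - mirror k l y) = norm (x - y)"
proof -
  have "norm (mirror k l x - mirror k l y) ^ 2 = norm (mirror k l x - y) ^ 2 + 4 * (x $ k - l) * (l - y $ k)"
    by (simp add: norm_diff_mirror mirror_nth algebra_simps)
  also have "norm (mirror k l x - y) ^ 2 = norm (x - y) ^ 2 + 4 * (l - x $ k) * (l - y $ k)"
    using norm_diff_mirror[of y k l x] by (simp add: norm_minus_commute algebra_simps)
  finally show ?thesis by (simp add: algebra_simps)
qed

lemma norm_diff_less_mirror:
  assumes "x $ k < l" "y $ k < l"
  shows "norm (x - y) < norm (x - mirror k l y)"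
proof -
  have "norm (x - y) ^ 2 < norm (x - mirror k l y) ^ 2"
    using assms by (simp add: norm_diff_mirror)
  then show ?thesis by (rule power2_less_imp_less) simp
qed

text \<open>
  Any two points on a vertical line are mirror images of each other, so positivity of all the
  differences \<open>u (mirror k l x) - u x\<close> below the planes is strict monotonicity of \<open>u\<close>.
\<close>

lemma horiz_eq_imp_mirror:
  assumes "horiz k x = horiz k y"
  shows "y = mirror k ((x $ k + y $ k) / 2) x"
  using assms by (auto simp: vec_eq_iff horiz_def mirror_nth field_simps split: if_splits)

lemma horiz_mirror [simp]: "horiz k (mirror k l x) = horiz k x"
  by (simp add: vec_eq_iff horiz_def mirror_nth)

section \<open>Integrability of power-type kernels\<close>

lemma lborel_integral_pos:
  fixes g :: "'a::euclidean_space \<Rightarrow> real"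
  assumes g: "integrable lborel g" and nn: "\<And>x. 0 \<le> g x" and pos: "\<And>x. x \<in> A \<Longrightarrow> 0 < g x"
    and A: "A \<in> sets borel" "emeasure lborel A \<noteq> 0"
  shows "0 < (LINT x|lborel. g x)"
proof (rule ccontr)
  assume "\<not> 0 < (LINT x|lborel. g x)"
  then have "(LINT x|lborel. g x) = 0"
    using nn by (meson Bochner_Integration.integral_nonneg order_antisym not_less)
  then have "AE x in lborel. g x = 0"
    using integral_nonneg_eq_0_iff_AE[OF g] nn by simp
  then have "AE x in lborel. x \<notin> A"
    by (rule eventually_mono) (use pos in force)
  then show False using A by (subst (asm) AE_iff_measurable[of A]) auto
qed

text \<open>
  A substitute for integration in polar coordinates: a function that is bounded by
  a constant on each dyadic shell is dominated by a sum of multiples of indicators of balls. For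
  power-type bounds the integral of that sum is a geometric series.
\<close>

lemma integrable_of_ball_majorant:
  fixes h :: "'a::euclidean_space \<Rightarrow> real"
  assumes h [measurable]: "h \<in> borel_measurable borel"
    and a: "\<And>n. a n \<ge> 0" and r: "\<And>n. r n \<ge> 0" and sm: "summable (\<lambda>n. a n * r n ^ DIM('a))"
    and le: "\<And>z. z \<noteq> 0 \<Longrightarrow> h z = 0 \<or> (\<exists>n. norm z \<le> r n \<and> \<bar>h z\<bar> \<le> a n)"
  shows "integrable lborel h"
proof (rule integrableI_bounded)
  have "(\<integral>\<^sup>+ z. ennreal (norm (h z)) \<partial>lborel) \<le> (\<integral>\<^sup>+ z. (\<Sum>n. ennreal (a n) * indicator (cball 0 (r n)) z) \<partial>(lborel::'a measure))"
  proof (rule nn_integral_mono_AE)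
    have "AE z in (lborel::'a measure). z \<noteq> 0" by (rule AE_lborel_singleton)
    then show "AE z in lborel. ennreal (norm (h z)) \<le> (\<Sum>n. ennreal (a n) * indicator (cball 0 (r n)) z)"
    proof eventually_elim
      case (elim z)
      define F where "F n = ennreal (a n) * indicator (cball 0 (r n)) z" for n
      from le[OF elim] show ?case
      proof (elim disjE exE conjE)
        fix n assume n: "norm z \<le> r n" "\<bar>h z\<bar> \<le> a n"
        have "ennreal (norm (h z)) \<le> ennreal (a n) * indicator (cball 0 (r n)) z"
          using n by (simp add: indicator_def ennreal_leI)
        also have "\<dots> = F n" by (simp add: F_def)
        also have "\<dots> \<le> (\<Sum>n. F n)" using sum_le_suminf[of F "{n}"] by simp
        finally show ?thesis by (simp add: F_def)
      qed simp
    qed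
  qed
  also have "\<dots> = (\<Sum>n. \<integral>\<^sup>+ z. ennreal (a n) * indicator (cball 0 (r n)) z \<partial>(lborel::'a measure))"
    by (rule nn_integral_suminf) (simp add: borel_measurable_times_ennreal borel_measurable_indicator)
  also have "\<dots> = (\<Sum>n. ennreal (unit_ball_vol (DIM('a)) * (a n * r n ^ DIM('a))))"
    by (intro suminf_cong, subst nn_integral_cmult_indicator)
       (auto simp: emeasure_cball r a ennreal_mult[symmetric] ac_simps)
  also have "\<dots> < \<infinity>"
    using summable_mult[OF sm, of "unit_ball_vol (DIM('a))"]
    by (subst suminf_ennreal2) (auto simp: a r intro!: mult_nonneg_nonneg)
  finally show "(\<integral>\<^sup>+ z. ennreal (norm (h z)) \<partial>lborel) < \<infinity>" .
qed simp

text \<open>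
  One power bound serves both ends: since \<open>0 < b < 2\<close>, the power \<open>r\<close> to
  \<open>- (N + b)\<close> is integrable at infinity, and it is integrable at the origin after
  multiplication by the quadratic gain \<open>r\<^sup>2\<close>.
\<close>

lemma integrable_levy_power:
  fixes J :: "real \<Rightarrow> real"
  assumes J [measurable]: "J \<in> borel_measurable borel" and J0: "\<And>r. 0 \<le> J r"
    and up: "\<And>r. 0 < r \<Longrightarrow> J r \<le> C * r powr (- (real DIM('a) + b))"
    and b: "0 < b" "b < 2"
  shows "integrable lborel (\<lambda>z::'a::euclidean_space. min 1 (norm z ^ 2) * J (norm z))"
proof -
  let ?N = "real DIM('a)"
  have C: "C \<ge> 0" using up[of 1] J0[of 1] by simp
  define h1 h2 :: "'a \<Rightarrow> real" where
    "h1 z = indicator (ball 0 1) z * (min 1 (norm z ^ 2) * J (norm z))" and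
    "h2 z = indicator (- ball 0 1) z * (min 1 (norm z ^ 2) * J (norm z))" for z
  have Jn [measurable]: "(\<lambda>z::'a. J (norm z)) \<in> borel_measurable borel"
    by (rule measurable_compose[OF _ J]) simp
  have [measurable]: "h1 \<in> borel_measurable borel" "h2 \<in> borel_measurable borel"
    unfolding h1_def h2_def by (intro borel_measurable_times borel_measurable_indicator borel_measurable_min Jn; simp)+
  define q1 where "q1 = (2::real) powr (-(2 - b))"
  define q2 where "q2 = (2::real) powr (-b)"
  have q: "0 < q1" "q1 < 1" "0 < q2" "q2 < 1"
    using b by (auto simp: q1_def q2_def powr_less_one)
  have i1: "integrable lborel h1"
  proof (rule integrable_of_ball_majorant[where
        a = "\<lambda>n. C * 2 powr (?N + b) * 2 powr (real n * (?N + b - 2))" and r = "\<lambda>n. 2 powr (- real n)"])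
    have "(\<lambda>n. C * 2 powr (?N + b) * 2 powr (real n * (?N + b - 2)) * (2 powr - real n) ^ DIM('a))
       = (\<lambda>n. C * 2 powr (?N + b) * q1 ^ n)"
      by (auto simp: fun_eq_iff q1_def powr_realpow[symmetric] powr_powr powr_add[symmetric] algebra_simps)
    then show "summable (\<lambda>n. C * 2 powr (?N + b) * 2 powr (real n * (?N + b - 2)) * (2 powr - real n) ^ DIM('a))"
      using q by (auto intro!: summable_mult summable_geometric)
    fix z :: 'a assume z: "z \<noteq> 0"
    show "h1 z = 0 \<or> (\<exists>n. norm z \<le> 2 powr - real n \<and> \<bar>h1 z\<bar> \<le> C * 2 powr (?N + b) * 2 powr (real n * (?N + b - 2)))"
    proof (cases "norm z < 1")
      case True
      \<comment> \<open>The index of the dyadic shell that contains z.\<close>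
      define n where "n = nat \<lfloor>- log 2 (norm z)\<rfloor>"
      have "log 2 (norm z) \<le> 0" using True z by simp
      then have n: "real n \<le> - log 2 (norm z)" "- log 2 (norm z) < real n + 1"
        unfolding n_def by linarith+
      have lz: "norm z = 2 powr (log 2 (norm z))" using z by simp
      have u: "norm z \<le> 2 powr - real n" using n by (subst lz, intro powr_mono) auto
      have l: "2 powr - (real n + 1) \<le> norm z" using n by (subst lz, intro powr_mono) auto
      have "\<bar>h1 z\<bar> = norm z ^ 2 * J (norm z)"
        using True by (simp add: h1_def J0 abs_mult min_absorb2 power_le_one)
      also have "\<dots> \<le> norm z ^ 2 * (C * norm z powr (- (?N + b)))"
        using z by (intro mult_left_mono up) auto
      also have "\<dots> \<le> (2 powr - real n) ^ 2 * (C * (2 powr - (real n + 1)) powr (- (?N + b)))"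
        using u l b C by (intro mult_mono power_mono powr_mono2' mult_left_mono) auto
      also have "\<dots> = C * 2 powr (?N + b) * 2 powr (real n * (?N + b - 2))"
        by (simp add: powr_realpow[symmetric] powr_powr powr_add[symmetric] algebra_simps)
      finally show ?thesis using u by blast
    qed (simp add: h1_def)
  qed (use C in auto)
  have i2: "integrable lborel h2"
  proof (rule integrable_of_ball_majorant[where
        a = "\<lambda>n. C * 2 powr (- real n * (?N + b))" and r = "\<lambda>n. 2 powr (real n + 1)"])
    have "(\<lambda>n. C * 2 powr (- real n * (?N + b)) * (2 powr (real n + 1)) ^ DIM('a))
       = (\<lambda>n. C * 2 powr ?N * q2 ^ n)"
      by (auto simp: fun_eq_iff q2_def powr_realpow[symmetric] powr_powr powr_add[symmetric] algebra_simps)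
    then show "summable (\<lambda>n. C * 2 powr (- real n * (?N + b)) * (2 powr (real n + 1)) ^ DIM('a))"
      using q by (auto intro!: summable_mult summable_geometric)
    fix z :: 'a assume z: "z \<noteq> 0"
    show "h2 z = 0 \<or> (\<exists>n. norm z \<le> 2 powr (real n + 1) \<and> \<bar>h2 z\<bar> \<le> C * 2 powr (- real n * (?N + b)))"
    proof (cases "norm z < 1")
      case False
      define n where "n = nat \<lfloor>log 2 (norm z)\<rfloor>"
      have "log 2 (norm z) \<ge> 0" using False z by simp
      then have n: "real n \<le> log 2 (norm z)" "log 2 (norm z) < real n + 1"
        unfolding n_def by linarith+
      have lz: "norm z = 2 powr (log 2 (norm z))" using z by simp
      have u: "norm z \<le> 2 powr (real n + 1)" using n by (subst lz, intro powr_mono) auto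
      have l: "2 powr real n \<le> norm z" using n by (subst lz, intro powr_mono) auto
      have "\<bar>h2 z\<bar> \<le> J (norm z)"
        using False by (simp add: h2_def J0 abs_mult min_def power_le_one)
      also have "\<dots> \<le> C * norm z powr (- (?N + b))"
        using z by (intro up) auto
      also have "\<dots> \<le> C * (2 powr real n) powr (- (?N + b))"
        using u l b C by (intro powr_mono2' mult_left_mono) auto
      also have "\<dots> = C * 2 powr (- real n * (?N + b))"
        by (simp add: powr_powr algebra_simps)
      finally show ?thesis using u by blast
    qed (simp add: h2_def)
  qed (use C in auto)
  have "(\<lambda>z::'a. min 1 (norm z ^ 2) * J (norm z)) = (\<lambda>z. h1 z + h2 z)"
    by (auto simp: h1_def h2_def fun_eq_iff indicator_def)
  then show ?thesis using i1 i2 by simp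
qed

section \<open>Estimates for the modified Bessel function\<close>

lemma exp_minus_le_powr:
  assumes "0 < p" "0 < (y::real)"
  shows "exp (- y) \<le> (p / y) powr p"
proof -
  have "ln (y / p) \<le> y / p" using ln_le_minus_one[of "y / p"] assms by simp
  then have "p * ln (y / p) \<le> y" using assms by (simp add: field_simps)
  then have "- y \<le> p * ln (p / y)" using assms by (simp add: ln_div algebra_simps)
  then show ?thesis using assms by (simp add: powr_def)
qed

abbreviation bessel_integrand :: "real \<Rightarrow> real \<Rightarrow> real \<Rightarrow> real" where
  "bessel_integrand \<nu> r t \<equiv> indicator {0..} t *\<^sub>R (exp (- r * cosh t) * cosh (\<nu> * t))"

text \<open>
  Trading \<open>exp (- r * cosh t)\<close> for the power \<open>(r * cosh t) powr (- p)\<close> with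
  \<open>p > \<nu>\<close> beats the growth of \<open>cosh (\<nu> * t)\<close> and leaves a convergent
  exponential integral.
\<close>

lemma bessel_integrand_le:
  assumes "0 \<le> \<nu>" "\<nu> < p" "0 < r"
  shows "bessel_integrand \<nu> r t \<le> (2 * p / r) powr p * (indicator {0..} t * exp (- ((p - \<nu>) * t)))"
proof (cases "t \<ge> 0")
  case True
  have c: "exp t / 2 \<le> cosh t" by (simp add: cosh_def)
  have c': "0 < cosh t" by simp
  have "exp (- r * cosh t) \<le> (p / (r * cosh t)) powr p"
    using exp_minus_le_powr[of p "r * cosh t"] assms c' by simp
  also have "\<dots> \<le> ((2 * p / r) * exp (- t)) powr p"
  proof (rule powr_mono2)
    have "p / (r * cosh t) \<le> p / (r * (exp t / 2))"
      using assms c by (intro divide_left_mono mult_left_mono mult_pos_pos) auto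
    then show "p / (r * cosh t) \<le> (2 * p / r) * exp (- t)" by (simp add: exp_minus field_simps)
  qed (use assms c' in auto)
  also have "\<dots> = (2 * p / r) powr p * exp (- (p * t))"
    using assms by (subst powr_mult) (auto simp: powr_def)
  finally have 1: "exp (- r * cosh t) \<le> (2 * p / r) powr p * exp (- (p * t))" .
  have 2: "cosh (\<nu> * t) \<le> exp (\<nu> * t)"
    using True assms by (simp add: cosh_def)
  have "exp (- r * cosh t) * cosh (\<nu> * t) \<le> ((2 * p / r) powr p * exp (- (p * t))) * exp (\<nu> * t)"
    using 1 2 by (intro mult_mono) auto
  also have "\<dots> = (2 * p / r) powr p * exp (- ((p - \<nu>) * t))"
    by (simp add: mult.assoc exp_add[symmetric] algebra_simps)
  finally show ?thesis using True by simp
qed simp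

lemma exp_half_line:
  assumes "0 < (a::real)"
  shows "integrable lborel (\<lambda>t. indicator {0..} t * exp (- (a * t)))"
    and "(LINT t|lborel. indicator {0..} t * exp (- (a * t))) = 1 / a"
proof -
  have "has_bochner_integral lborel (\<lambda>t. indicator {0..} t * exp (- (a * t))) (1 / a)"
  proof (rule has_bochner_integral_nn_integral)
    have "(\<integral>\<^sup>+ t. ennreal (indicator {0..} t * exp (- (a * t))) \<partial>lborel)
       = (\<integral>\<^sup>+ t. ennreal (exp (- (a * t))) * indicator {0..} t \<partial>lborel)"
      by (intro nn_integral_cong) (simp add: indicator_def)
    also have "\<dots> = ennreal (0 - (- exp (- (a * 0)) / a))"
    proof (rule nn_integral_FTC_atLeast[where F = "\<lambda>t. - exp (- (a * t)) / a"])
      have "((\<lambda>t. exp (- (a * t))) \<longlongrightarrow> 0) at_top"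
        using assms by (auto intro!: exp_at_bot[THEN filterlim_compose] filterlim_tendsto_pos_mult_at_top[OF tendsto_const]
          simp: filterlim_uminus_at_bot filterlim_ident)
      then show "((\<lambda>t. - exp (- (a * t)) / a) \<longlongrightarrow> 0) at_top"
        using tendsto_divide[OF tendsto_minus tendsto_const[of a]] assms by fastforce
    qed (use assms in \<open>auto intro!: derivative_eq_intros\<close>)
    finally show "(\<integral>\<^sup>+ t. ennreal (indicator {0..} t * exp (- (a * t))) \<partial>lborel) = ennreal (1 / a)" by simp
  qed (use assms in auto)
  then show "integrable lborel (\<lambda>t. indicator {0..} t * exp (- (a * t)))"
    and "(LINT t|lborel. indicator {0..} t * exp (- (a * t))) = 1 / a"
    by (auto simp: has_bochner_integral_iff)
qed

lemma bessel_integrand_measurable [measurable]: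
  "(\<lambda>(r, t). bessel_integrand \<nu> r t) \<in> borel_measurable (borel \<Otimes>\<^sub>M borel)"
  unfolding cosh_def by measurable

lemma bessel_integrand_integrable:
  assumes "0 \<le> \<nu>" "0 < r"
  shows "integrable lborel (bessel_integrand \<nu> r)"
proof (rule Bochner_Integration.integrable_bound)
  show "integrable lborel (\<lambda>t. (2 * (\<nu> + 1) / r) powr (\<nu> + 1) * (indicator {0..} t * exp (- ((\<nu> + 1 - \<nu>) * t))))"
    by (intro integrable_mult_right exp_half_line) simp
  show "bessel_integrand \<nu> r \<in> borel_measurable lborel"
    unfolding cosh_def by measurable
  show "AE t in lborel. norm (bessel_integrand \<nu> r t)
      \<le> norm ((2 * (\<nu> + 1) / r) powr (\<nu> + 1) * (indicator {0..} t * exp (- ((\<nu> + 1 - \<nu>) * t))))"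
    using bessel_integrand_le[of \<nu> "\<nu> + 1" r] assms
    by (intro AE_I2) (auto simp: abs_mult indicator_def)
qed

lemma bessel_K_eq: "bessel_K \<nu> r = (LINT t|lborel. bessel_integrand \<nu> r t)"
  by (simp add: bessel_K_def set_lebesgue_integral_def)

lemma bessel_K_measurable [measurable]: "bessel_K \<nu> \<in> borel_measurable borel"
  unfolding bessel_K_eq[abs_def]
  by (rule lborel.borel_measurable_lebesgue_integral) (use bessel_integrand_measurable[of \<nu>] in simp)

lemma bessel_K_nonneg: "0 \<le> bessel_K \<nu> r"
  unfolding bessel_K_eq by (intro Bochner_Integration.integral_nonneg) (auto simp: indicator_def)

text \<open>
  The true order of the singularity is \<open>\<nu>\<close>, but the comparison integral diverges there, so the
  exponent \<open>p\<close> has to be larger. The loss is harmless: a power with \<open>p\<close> slightly above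
  \<open>\<nu>\<close> still satisfies the integrability condition at the origin, and it decays fast enough at
  infinity to replace the exponential decay.
\<close>

lemma bessel_K_le_powr:
  assumes "0 \<le> \<nu>" "\<nu> < p" "0 < r"
  shows "bessel_K \<nu> r \<le> (2 * p) powr p / (p - \<nu>) * r powr (- p)"
proof -
  have "bessel_K \<nu> r \<le> (LINT t|lborel. (2 * p / r) powr p * (indicator {0..} t * exp (- ((p - \<nu>) * t))))"
    unfolding bessel_K_eq using assms
    by (intro integral_mono bessel_integrand_integrable bessel_integrand_le integrable_mult_right exp_half_line) auto
  also have "\<dots> = (2 * p) powr p / (p - \<nu>) * r powr (- p)"
    using assms by (simp add: exp_half_line powr_divide powr_minus divide_simps)
  finally show ?thesis .
qed

lemma bessel_K_strict_antimono:
  assumes "0 \<le> \<nu>" "0 < r" "r < r'"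
  shows "bessel_K \<nu> r' < bessel_K \<nu> r"
proof -
  have lt: "exp (- r' * cosh t) * cosh (\<nu> * t) < exp (- r * cosh t) * cosh (\<nu> * t)" for t
    using assms by (intro mult_strict_right_mono) auto
  have int: "integrable lborel (bessel_integrand \<nu> r)" "integrable lborel (bessel_integrand \<nu> r')"
    using assms by (intro bessel_integrand_integrable; linarith)+
  have "0 < (LINT t|lborel. bessel_integrand \<nu> r t - bessel_integrand \<nu> r' t)"
    using lt by (intro lborel_integral_pos[where A = "{0..1}"] Bochner_Integration.integrable_diff int)
      (auto simp: indicator_def less_imp_le)
  then show ?thesis
    unfolding bessel_K_eq by (subst (asm) Bochner_Integration.integral_diff[OF int]) linarith
qed

text \<open>
  The integrand is of order \<open>exp (\<nu> * t)\<close> up to the time \<open>T = - ln r\<close> at which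
  \<open>r * exp t\<close> reaches 1. Its last unit of time \<open>[T - 1, T]\<close> already produces the
  singularity \<open>r powr (- \<nu>)\<close>.
\<close>

lemma bessel_K_ge_powr:
  assumes "0 \<le> \<nu>" "0 < r" "r \<le> exp (- 1)"
  shows "exp (- 1 - \<nu>) / 2 * r powr (- \<nu>) \<le> bessel_K \<nu> r"
proof -
  define T where "T = - ln r"
  have "ln r \<le> - 1" using assms by (metis ln_exp ln_le_cancel_iff exp_gt_zero)
  then have T: "1 \<le> T" by (simp add: T_def)
  have rT: "r * exp T = 1" using assms by (simp add: T_def exp_minus)
  have p: "exp (\<nu> * (T - 1)) = exp (- \<nu>) * r powr (- \<nu>)"
    using assms by (simp add: T_def powr_def exp_add[symmetric] algebra_simps)
  define c where "c = exp (- 1) * (exp (\<nu> * (T - 1)) / 2)"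
  have "c = (LINT t|lborel. c * indicator {T - 1..T} t)" by simp
  also have "\<dots> \<le> bessel_K \<nu> r"
    unfolding bessel_K_eq
  proof (intro integral_mono bessel_integrand_integrable assms)
    show "integrable lborel (\<lambda>t. c * indicator {T - 1..T} t)" by simp
    fix t
    show "c * indicator {T - 1..T} t \<le> bessel_integrand \<nu> r t"
    proof (cases "t \<in> {T - 1..T}")
      case True
      then have t: "0 \<le> t" "T - 1 \<le> t" "t \<le> T" using T by auto
      have "cosh t \<le> exp t" using t by (simp add: cosh_def)
      then have "r * cosh t \<le> r * exp T" using t assms by (intro mult_left_mono) (auto intro: order_trans)
      then have 1: "exp (- 1) \<le> exp (- r * cosh t)" by (simp add: rT)
      have "exp (\<nu> * (T - 1)) / 2 \<le> exp (\<nu> * t) / 2" using t assms by (simp add: mult_left_mono)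
      also have "\<dots> \<le> cosh (\<nu> * t)" by (simp add: cosh_def)
      finally have "c \<le> exp (- r * cosh t) * cosh (\<nu> * t)"
        unfolding c_def using 1 by (intro mult_mono) auto
      then show ?thesis using t True by simp
    qed (auto simp: indicator_def)
  qed
  finally show ?thesis unfolding c_def p by (simp add: exp_diff exp_minus field_simps)
qed

section \<open>Radial Levy kernels and their principal values\<close>

text \<open>
  The gradient at \<open>x\<close> cancels in the symmetric second difference, so a Lipschitz gradient gives a
  quadratic bound; this is what makes the principal value converge.
\<close>

lemma second_difference_le:
  fixes u :: "'a::euclidean_space \<Rightarrow> real"
  assumes g: "\<And>y. y \<in> ball x \<rho> \<Longrightarrow> GDERIV u y :> g y"
    and L: "L-lipschitz_on (ball x \<rho>) g" and z: "norm z < \<rho>"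
  shows "\<bar>2 * u x - u (x + z) - u (x - z)\<bar> \<le> 2 * L * norm z ^ 2"
proof -
  have d: "((\<lambda>t. u (x + t *\<^sub>R v)) has_real_derivative v \<bullet> g (x + t *\<^sub>R v)) (at t)"
    if "norm (t *\<^sub>R v) < \<rho>" for t v
  proof -
    have "x + t *\<^sub>R v \<in> ball x \<rho>" using that by (simp add: dist_norm)
    then have 1: "(u has_derivative (\<lambda>h. h \<bullet> g (x + t *\<^sub>R v))) (at (x + t *\<^sub>R v))"
      using g by (simp add: gderiv_def)
    have 2: "((\<lambda>t. x + t *\<^sub>R v) has_derivative (\<lambda>s. s *\<^sub>R v)) (at t)"
      by (auto intro!: derivative_eq_intros)
    show ?thesis
      using has_derivative_compose[OF 2 1] unfolding has_field_derivative_def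
      by (rule has_derivative_eq_rhs) (auto simp: mult.commute)
  qed
  have nz: "norm (t *\<^sub>R z) < \<rho>" "norm (t *\<^sub>R z) \<le> norm z" if "0 \<le> t" "t \<le> 1" for t
    using that z mult_right_mono[of t 1 "norm z"] by auto
  define h where "h t = u (x + t *\<^sub>R z) + u (x + t *\<^sub>R (- z))" for t
  define h' where "h' t = z \<bullet> g (x + t *\<^sub>R z) + (- z) \<bullet> g (x + t *\<^sub>R (- z))" for t
  have "(h has_real_derivative h' t) (at t)" if "0 \<le> t" "t \<le> 1" for t
    unfolding h_def h'_def using nz[OF that] by (intro DERIV_add d) auto
  then obtain t where t: "0 < t" "t < 1" "h 1 - h 0 = (1 - 0) * h' t"
    using MVT2[of 0 1 h h'] by auto
  have "\<bar>h' t\<bar> = \<bar>z \<bullet> (g (x + t *\<^sub>R z) - g (x + t *\<^sub>R (- z)))\<bar>"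
    by (simp add: h'_def inner_diff_right)
  also have "\<dots> \<le> norm z * norm (g (x + t *\<^sub>R z) - g (x + t *\<^sub>R (- z)))"
    by (rule Cauchy_Schwarz_ineq2)
  also have "\<dots> \<le> norm z * (L * norm ((x + t *\<^sub>R z) - (x + t *\<^sub>R (- z))))"
    using lipschitz_onD[OF L, of "x + t *\<^sub>R z" "x + t *\<^sub>R (- z)"] t nz[of t]
    by (intro mult_left_mono) (auto simp: dist_norm)
  also have "(x + t *\<^sub>R z) - (x + t *\<^sub>R (- z)) = (2 * t) *\<^sub>R z"
    by (simp add: scaleR_2[symmetric])
  also have "norm z * (L * norm ((2 * t) *\<^sub>R z)) \<le> norm z * (L * (2 * norm z))"
    using t lipschitz_on_nonneg[OF L] nz(2)[of t] by (intro mult_left_mono) auto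
  finally have "\<bar>h 1 - h 0\<bar> \<le> 2 * L * norm z ^ 2"
    using t by (simp add: power2_eq_square mult_ac)
  then show ?thesis by (simp add: h_def abs_minus_commute algebra_simps)
qed

definition mirror_diff :: "'n::finite \<Rightarrow> real \<Rightarrow> (real ^ 'n \<Rightarrow> real) \<Rightarrow> real ^ 'n \<Rightarrow> real" where
  "mirror_diff k l u x = u (mirror k l x) - u x"

lemma mirror_diff_mirror [simp]: "mirror_diff k l u (mirror k l x) = - mirror_diff k l u x"
  by (simp add: mirror_diff_def)

text \<open>
  The kernel of \<open>(-\<Delta> + m\<^sup>2)\<^sup>s\<close> enters the proof only through these
  properties. \<open>J_levy\<close> is the usual integrability condition on a Levy kernel.
  \<open>J_singular\<close> says that the mass of the kernel near distance \<open>d\<close> from its centre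
  tends to infinity as \<open>d\<close> tends to 0, which drives the narrow region principle; the factor 3
  is the bound on the distances met there, in units of the distance to the plane. The parameter
  \<open>k\<close> names the direction in which the planes move.
\<close>

locale radial_levy_kernel =
  fixes k :: "'n::finite" and J :: "real \<Rightarrow> real"
  assumes J_measurable [measurable]: "J \<in> borel_measurable borel"
    and J_nonneg: "0 \<le> J r"
    and J_strict: "0 < r \<Longrightarrow> r < r' \<Longrightarrow> J r' < J r"
    and J_levy: "integrable lborel (\<lambda>z :: real ^ 'n. min 1 (norm z ^ 2) * J (norm z))"
    and J_singular: "\<exists>\<delta>>0. \<forall>d. 0 < d \<and> d < \<delta> \<longrightarrow> C \<le> d ^ CARD('n) * J (3 * d)"
begin

lemma J_mono: "0 < r \<Longrightarrow> r \<le> r' \<Longrightarrow> J r' \<le> J r"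
  using J_strict[of r r'] by (cases "r = r'") auto

definition admissible :: "(real ^ 'n \<Rightarrow> real) \<Rightarrow> bool" where
  "admissible u \<longleftrightarrow> continuous_on UNIV u \<and>
     (\<forall>x. integrable lborel (\<lambda>y. indicator (- ball x 1) y * (\<bar>u y\<bar> * J (norm (x - y)))))"

abbreviation trunc_integrand :: "(real ^ 'n \<Rightarrow> real) \<Rightarrow> real \<Rightarrow> real ^ 'n \<Rightarrow> real ^ 'n \<Rightarrow> real" where
  "trunc_integrand u \<epsilon> x y \<equiv> indicator (- ball x \<epsilon>) y * ((u x - u y) * J (norm (x - y)))"

text \<open>
  The principal value at \<open>x\<close> is the limit of \<open>trunc u \<epsilon> x\<close> as
  \<open>\<epsilon>\<close> decreases to 0. Results about it take the limit \<open>P\<close> as a hypothesis, since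
  \<open>Lim\<close> carries no information where the limit does not exist.
\<close>

definition trunc :: "(real ^ 'n \<Rightarrow> real) \<Rightarrow> real \<Rightarrow> real ^ 'n \<Rightarrow> real" where
  "trunc u \<epsilon> x = (LINT y|lborel. trunc_integrand u \<epsilon> x y)"

lemma J_norm_measurable [measurable]: "(\<lambda>y :: real ^ 'n. J (norm (x - y))) \<in> borel_measurable borel"
  by (rule measurable_compose[OF _ J_measurable]) simp

lemma admissible_measurable: "admissible u \<Longrightarrow> u \<in> borel_measurable borel"
  by (simp add: admissible_def borel_measurable_continuous_onI)

lemma integrable_levy_at:
  "integrable lborel (\<lambda>y :: real ^ 'n. min 1 (norm (x - y) ^ 2) * J (norm (x - y)))"
proof -
  have "integrable lborel (\<lambda>y. (\<lambda>z :: real ^ 'n. min 1 (norm z ^ 2) * J (norm z)) (x + (- 1) *\<^sub>R y))"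
    by (subst integral_measure_preserving(1)[OF distr_lborel_translation_sign])
       (use J_levy in \<open>auto dest: borel_measurable_integrable\<close>)
  then show ?thesis by simp
qed

lemma trunc_integrand_integrable:
  assumes u: "admissible u" and e: "0 < \<epsilon>"
  shows "integrable lborel (trunc_integrand u \<epsilon> x)"
proof -
  note [measurable] = admissible_measurable[OF u]
  have "bounded (u ` cball x 1)"
    using u by (intro compact_imp_bounded compact_continuous_image)
      (auto simp: admissible_def intro: continuous_on_subset)
  then obtain M where "\<forall>v\<in>u ` cball x 1. norm v \<le> M"
    unfolding bounded_iff by blast
  then have M: "\<bar>u y\<bar> \<le> M" if "y \<in> cball x 1" for y using that by auto
  have M0: "0 \<le> M" using M[of x] by auto
  define c where "c = (\<bar>u x\<bar> + M) / min 1 (\<epsilon> ^ 2)"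
  define G where "G y = indicator (- ball x 1) y * (\<bar>u y\<bar> * J (norm (x - y)))
      + c * (min 1 (norm (x - y) ^ 2) * J (norm (x - y)))" for y
  show ?thesis
  proof (rule Bochner_Integration.integrable_bound[of _ G])
    show "integrable lborel G"
      unfolding G_def using u integrable_levy_at
      by (intro Bochner_Integration.integrable_add integrable_mult_right) (auto simp: admissible_def)
    show "trunc_integrand u \<epsilon> x \<in> borel_measurable lborel"
      by (intro borel_measurable_times borel_measurable_indicator) auto
    show "AE y in lborel. norm (trunc_integrand u \<epsilon> x y) \<le> norm (G y)"
    proof (intro AE_I2)
      fix y
      have c0: "0 \<le> c" using M0 e by (auto simp: c_def)
      show "norm (trunc_integrand u \<epsilon> x y) \<le> norm (G y)"
      proof (cases "y \<in> ball x \<epsilon>")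
        case False
        then have n: "\<epsilon> \<le> norm (x - y)" by (simp add: dist_norm)
        have "min 1 (\<epsilon> ^ 2) \<le> min 1 (norm (x - y) ^ 2)"
          using n e by (intro min.mono power_mono) auto
        then have "c * min 1 (\<epsilon> ^ 2) \<le> c * min 1 (norm (x - y) ^ 2)" using c0 by (rule mult_left_mono)
        moreover have "min 1 (\<epsilon> ^ 2) \<noteq> 0" using e by (auto simp: min_def)
        ultimately have c1: "\<bar>u x\<bar> + M \<le> c * min 1 (norm (x - y) ^ 2)" by (simp add: c_def)
        have "\<bar>u x - u y\<bar> \<le> indicator (- ball x 1) y * \<bar>u y\<bar> + c * min 1 (norm (x - y) ^ 2)"
          using M[of y] M0 c1 by (cases "y \<in> ball x 1") auto
        then have "\<bar>u x - u y\<bar> * J (norm (x - y))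
            \<le> (indicator (- ball x 1) y * \<bar>u y\<bar> + c * min 1 (norm (x - y) ^ 2)) * J (norm (x - y))"
          using J_nonneg by (rule mult_right_mono)
        also have "\<dots> = G y" by (simp only: G_def distrib_right mult.assoc)
        finally have "\<bar>u x - u y\<bar> * J (norm (x - y)) \<le> G y" .
        then show ?thesis using False J_nonneg by (simp add: abs_mult)
      qed simp
    qed
  qed
qed

text \<open>
  Averaging the substitutions \<open>y = x + z\<close> and \<open>y = x - z\<close> replaces the first difference,
  which is only conditionally integrable at the singularity, by the second difference.
\<close>

lemma trunc_eq_second_difference:
  assumes u: "admissible u" and e: "0 < \<epsilon>"
  shows "integrable lborel (\<lambda>z. indicator (- ball 0 \<epsilon>) z * ((2 * u x - u (x + z) - u (x - z)) * J (norm z)))"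
    and "trunc u \<epsilon> x
      = (LINT z|lborel. indicator (- ball 0 \<epsilon>) z * ((2 * u x - u (x + z) - u (x - z)) * J (norm z))) / 2"
proof -
  note int = trunc_integrand_integrable[OF assms, of x]
  note meas = borel_measurable_integrable[OF int, simplified]
  have t: "distr lborel borel (\<lambda>z. x + c *\<^sub>R z) = lborel" if "\<bar>c\<bar> = 1" for c
    using distr_lborel_translation_sign[OF that] .
  have *: "integrable lborel (\<lambda>z. trunc_integrand u \<epsilon> x (x + c *\<^sub>R z))"
    "(LINT z|lborel. trunc_integrand u \<epsilon> x (x + c *\<^sub>R z)) = trunc u \<epsilon> x" if "\<bar>c\<bar> = 1" for c
    using integral_measure_preserving[OF t[OF that] _ meas] int by (auto simp: trunc_def)
  have "(\<lambda>z. indicator (- ball 0 \<epsilon>) z * ((2 * u x - u (x + z) - u (x - z)) * J (norm z)))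
      = (\<lambda>z. trunc_integrand u \<epsilon> x (x + 1 *\<^sub>R z) + trunc_integrand u \<epsilon> x (x + (- 1) *\<^sub>R z))"
    by (auto simp: fun_eq_iff indicator_def dist_norm algebra_simps)
  then show "integrable lborel (\<lambda>z. indicator (- ball 0 \<epsilon>) z * ((2 * u x - u (x + z) - u (x - z)) * J (norm z)))"
    and "trunc u \<epsilon> x
      = (LINT z|lborel. indicator (- ball 0 \<epsilon>) z * ((2 * u x - u (x + z) - u (x - z)) * J (norm z))) / 2"
    using *[of 1] *[of "- 1"] by (simp_all add: Bochner_Integration.integral_add)
qed

text \<open>
  Dominated convergence: near the origin the second difference is quadratic and \<open>J_levy\<close>
  applies, and away from it the truncated integrand is itself a majorant.
\<close>

lemma trunc_converges:
  assumes u: "admissible u" and \<Omega>: "open \<Omega>" "u \<in> C11_loc \<Omega>" "x \<in> \<Omega>"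
  shows "\<exists>P. ((\<lambda>\<epsilon>. trunc u \<epsilon> x) \<longlongrightarrow> P) (at_right 0)"
proof -
  note [measurable] = admissible_measurable[OF u]
  obtain g where g: "\<And>y. y \<in> \<Omega> \<Longrightarrow> GDERIV u y :> g y"
    and gL: "\<forall>y\<in>\<Omega>. \<exists>r>0. \<exists>L. L-lipschitz_on (ball y r \<inter> \<Omega>) g"
    using \<Omega>(2) unfolding C11_loc_def by auto
  obtain r L where r: "r > 0" and L: "L-lipschitz_on (ball x r \<inter> \<Omega>) g"
    using gL \<Omega>(3) by blast
  obtain r' where r': "r' > 0" "ball x r' \<subseteq> \<Omega>" using \<Omega> openE by metis
  define \<rho> where "\<rho> = min 1 (min r r')"
  have \<rho>: "0 < \<rho>" "\<rho> \<le> 1" "ball x \<rho> \<subseteq> ball x r \<inter> \<Omega>" using r r' by (auto simp: \<rho>_def)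
  define D where "D z = (2 * u x - u (x + z) - u (x - z)) * J (norm z)" for z
  have Jn: "(\<lambda>z :: real ^ 'n. J (norm z)) \<in> borel_measurable borel"
    by (rule measurable_compose[OF _ J_measurable]) simp
  have Dm [measurable]: "D \<in> borel_measurable borel"
    unfolding D_def using Jn by (intro borel_measurable_times) auto
  have L0: "0 \<le> L" by (rule lipschitz_on_nonneg[OF L])
  \<comment> \<open>The integrable majorant: its first term is used on the ball of radius \<rho>, its second outside.\<close>
  define W where "W z = 2 * L * (min 1 (norm z ^ 2) * J (norm z)) + \<bar>indicator (- ball 0 \<rho>) z * D z\<bar>" for z
  have W: "integrable lborel W"
    unfolding W_def D_def using trunc_eq_second_difference(1)[OF u \<rho>(1)]
    by (intro Bochner_Integration.integrable_add integrable_mult_right J_levy integrable_abs)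
  have DW: "\<bar>D z\<bar> \<le> W z" for z
  proof (cases "norm z < \<rho>")
    case True
    have "\<bar>2 * u x - u (x + z) - u (x - z)\<bar> \<le> 2 * L * norm z ^ 2"
      using \<rho> True by (intro second_difference_le[where g = g and \<rho> = \<rho>] g lipschitz_on_subset[OF L]) auto
    then have "\<bar>D z\<bar> \<le> 2 * L * norm z ^ 2 * J (norm z)"
      unfolding D_def abs_mult using J_nonneg by (simp add: mult_right_mono)
    moreover have "min 1 (norm z ^ 2) = norm z ^ 2" using True \<rho> by (simp add: min_absorb2 power_le_one)
    ultimately show ?thesis by (simp add: W_def mult.assoc)
  next
    case False
    then show ?thesis using J_nonneg L0 by (simp add: W_def)
  qed
  have "((\<lambda>\<epsilon>. (LINT z|lborel. indicator (- ball 0 \<epsilon>) z * D z) / 2) \<longlongrightarrow> (LINT z|lborel. D z) / 2) (at_right 0)"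
  proof (rule tendsto_at_right_sequentially[of 0 1])
    fix S :: "nat \<Rightarrow> real"
    assume S: "\<And>n. 0 < S n" "S \<longlonglongrightarrow> 0"
    show "(\<lambda>n. (LINT z|lborel. indicator (- ball 0 (S n)) z * D z) / 2) \<longlonglongrightarrow> (LINT z|lborel. D z) / 2"
    proof (intro tendsto_divide tendsto_const integral_dominated_convergence[where w = W])
      show "AE z in lborel. (\<lambda>n. indicator (- ball 0 (S n)) z * D z) \<longlonglongrightarrow> D z"
      proof -
        have "AE z in (lborel :: (real ^ 'n) measure). z \<noteq> 0" by (rule AE_lborel_singleton)
        then show ?thesis
        proof eventually_elim
          case (elim z)
          have "eventually (\<lambda>n. S n < norm z) sequentially"
            using S(2) elim by (intro order_tendstoD(2)[OF S(2)]) simp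
          then have "eventually (\<lambda>n. indicator (- ball 0 (S n)) z * D z = D z) sequentially"
            by eventually_elim simp
          then show ?case by (rule tendsto_eventually)
        qed
      qed
      show "AE z in lborel. norm (indicator (- ball 0 (S n)) z * D z) \<le> W z" for n
        using DW order_trans[OF abs_ge_zero DW] by (intro AE_I2) (auto simp: indicator_def)
      show "(\<lambda>z. indicator (- ball 0 (S n)) z * D z) \<in> borel_measurable lborel" for n
        by (intro borel_measurable_times borel_measurable_indicator) auto
    qed (use W in auto)
  qed simp
  moreover have "eventually (\<lambda>\<epsilon>. (LINT z|lborel. indicator (- ball 0 \<epsilon>) z * D z) / 2 = trunc u \<epsilon> x) (at_right 0)"
    unfolding eventually_at_filter D_def
    by (rule always_eventually) (auto simp: trunc_eq_second_difference(2)[OF u])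
  ultimately show ?thesis by (blast intro: Lim_transform_eventually)
qed

section \<open>Maximum principles for mirror differences\<close>

abbreviation comparison_integrand ::
    "(real ^ 'n \<Rightarrow> real) \<Rightarrow> real \<Rightarrow> real ^ 'n \<Rightarrow> real ^ 'n \<Rightarrow> real" where
  "comparison_integrand u l x y \<equiv>
     2 * mirror_diff k l u x * J (norm (x - mirror k l y))
     - (mirror_diff k l u y - mirror_diff k l u x) * (J (norm (x - y)) - J (norm (x - mirror k l y)))"

text \<open>
  The maximum principle for antisymmetric functions, in quantitative form. Let \<open>w\<close> be the mirror
  difference of \<open>u\<close> and \<open>y'\<close> the mirror image of \<open>y\<close>. Since
  \<open>w y' = - w y\<close>, folding the integral over the upper half-space onto the lower one turns the
  integrand at \<open>y\<close> into
  \<open>(w x - w y) * J \<bar>x - y\<bar> + (w x + w y) * J \<bar>x - y'\<bar>\<close>, which is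
  \<open>comparison_integrand\<close>. At a nonpositive minimum \<open>x\<close> both of its terms are nonpositive
  because the mirror image is farther away and \<open>J\<close> decreases. Hence it may be discarded outside
  any set \<open>B\<close> of the lower half-space, and a set \<open>B\<close> that stays away from \<open>x\<close>
  avoids the singularity.
\<close>

lemma mirror_comparison:
  assumes u: "admissible u" and xl: "x $ k < l"
    and P: "((\<lambda>\<epsilon>. trunc u \<epsilon> x) \<longlongrightarrow> P) (at_right 0)"
    and P': "((\<lambda>\<epsilon>. trunc u \<epsilon> (mirror k l x)) \<longlongrightarrow> P') (at_right 0)"
    and min: "\<And>y. y $ k < l \<Longrightarrow> mirror_diff k l u x \<le> mirror_diff k l u y"
    and nonpos: "mirror_diff k l u x \<le> 0"
    and B: "B \<in> sets borel" "B \<subseteq> {y. y $ k < l}" "B \<inter> ball x r = {}" "0 < r"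
  shows "integrable lborel (\<lambda>y. indicator B y * comparison_integrand u l x y)" (is ?int)
    and "P' - P \<le> (LINT y|lborel. indicator B y * comparison_integrand u l x y)" (is ?le)
proof -
  let ?R = "mirror k l"
  let ?H = "{y :: real ^ 'n. y $ k < l}"
  define w where "w = mirror_diff k l u"
  define d where "d = l - x $ k"
  define E where "E y = comparison_integrand u l x y" for y
  define Q where "Q \<epsilon> y = indicator (- ball x \<epsilon>) y * ((w x - w y) * J (norm (x - y)))" for \<epsilon> y
  have H [measurable]: "?H \<in> sets borel"
    by (intro borel_open open_Collect_less continuous_intros)
  have d: "0 < d" using xl by (simp add: d_def)
  have ud: "continuous_on UNIV w"
    using u unfolding w_def mirror_diff_def[abs_def] admissible_def
    by (intro continuous_intros continuous_on_compose2[of UNIV u UNIV "mirror k l"]) auto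
  have Q1: "integrable lborel (Q \<epsilon>)" "trunc u \<epsilon> (?R x) - trunc u \<epsilon> x = (LINT y|lborel. Q \<epsilon> y)"
    if "0 < \<epsilon>" for \<epsilon>
  proof -
    note int = trunc_integrand_integrable[OF u that]
    note meas = borel_measurable_integrable[OF int, simplified]
    have 1: "integrable lborel (\<lambda>y. trunc_integrand u \<epsilon> (?R x) (?R y))"
      "(LINT y|lborel. trunc_integrand u \<epsilon> (?R x) (?R y)) = trunc u \<epsilon> (?R x)"
      using integral_measure_preserving[OF distr_lborel_mirror mirror_measurable meas] int
      by (auto simp: trunc_def)
    have "Q \<epsilon> = (\<lambda>y. trunc_integrand u \<epsilon> (?R x) (?R y) - trunc_integrand u \<epsilon> x y)"
      by (auto simp: fun_eq_iff Q_def indicator_def dist_norm norm_mirror_diff_mirror w_def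
            mirror_diff_def algebra_simps)
    then show "integrable lborel (Q \<epsilon>)" "trunc u \<epsilon> (?R x) - trunc u \<epsilon> x = (LINT y|lborel. Q \<epsilon> y)"
      using 1 int[of x] by (simp_all add: trunc_def)
  qed
  \<comment> \<open>Folding the upper half-space onto the lower one. The plane itself is not discarded as a null set:
    there w vanishes, so Q is nonpositive and can be dropped from an upper bound.\<close>
  have Q2: "integrable lborel (\<lambda>y. Q \<epsilon> (?R y))" "(LINT y|lborel. Q \<epsilon> y) \<le> (LINT y|lborel. indicator ?H y * (Q \<epsilon> y + Q \<epsilon> (?R y)))"
    "integrable lborel (\<lambda>y. indicator ?H y * (Q \<epsilon> y + Q \<epsilon> (?R y)))"
    if "0 < \<epsilon>" for \<epsilon>
  proof -
    note int = Q1(1)[OF that]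
    note meas = borel_measurable_integrable[OF int, simplified]
    show QR: "integrable lborel (\<lambda>y. Q \<epsilon> (?R y))"
      using integral_measure_preserving(1)[OF distr_lborel_mirror mirror_measurable meas] int by simp
    have i1: "integrable lborel (\<lambda>y. indicator ?H y * Q \<epsilon> y)" "integrable lborel (\<lambda>y. indicator ?H y * Q \<epsilon> (?R y))"
      using integrable_mult_indicator[OF _ int, of ?H] integrable_mult_indicator[OF _ QR, of ?H] H by simp_all
    have m3: "(\<lambda>y. indicator ?H y * Q \<epsilon> (?R y)) \<in> borel_measurable borel"
      using borel_measurable_integrable[OF i1(2)] by simp
    have i3: "integrable lborel (\<lambda>y. indicator ?H (?R y) * Q \<epsilon> y)"
      "(LINT y|lborel. indicator ?H (?R y) * Q \<epsilon> y) = (LINT y|lborel. indicator ?H y * Q \<epsilon> (?R y))"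
      using integral_measure_preserving[OF distr_lborel_mirror[of k l] mirror_measurable m3] i1(2) by simp_all
    have "(LINT y|lborel. Q \<epsilon> y) \<le> (LINT y|lborel. indicator ?H y * Q \<epsilon> y + indicator ?H (?R y) * Q \<epsilon> y)"
    proof (intro integral_mono int Bochner_Integration.integrable_add i1 i3)
      fix y
      show "Q \<epsilon> y \<le> indicator ?H y * Q \<epsilon> y + indicator ?H (?R y) * Q \<epsilon> y"
      proof (cases "y $ k = l")
        case True
        then have "?R y = y" by (simp add: vec_eq_iff mirror_nth)
        then have "w y = 0" by (simp add: w_def mirror_diff_def)
        then have "Q \<epsilon> y \<le> 0"
          using nonpos J_nonneg by (simp add: Q_def w_def mult_nonneg_nonpos mult_nonpos_nonneg)
        then show ?thesis using True by (simp add: mirror_nth)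
      qed (auto simp: indicator_def mirror_nth)
    qed
    also have "\<dots> = (LINT y|lborel. indicator ?H y * (Q \<epsilon> y + Q \<epsilon> (?R y)))"
      using i1 i3 by (simp add: distrib_left)
    finally show "(LINT y|lborel. Q \<epsilon> y) \<le> (LINT y|lborel. indicator ?H y * (Q \<epsilon> y + Q \<epsilon> (?R y)))" .
    show "integrable lborel (\<lambda>y. indicator ?H y * (Q \<epsilon> y + Q \<epsilon> (?R y)))"
      using i1 by (simp add: distrib_left)
  qed
  \<comment> \<open>The mirrored kernel has no singularity below the plane, so the integral over the excised ball,
    where only the mirrored term survives, is of the order of the volume of that ball.\<close>
  have far: "d \<le> norm (x - ?R y)" if "y $ k < l" for y
    using component_le_norm_cart[of "x - ?R y" k] that by (simp add: d_def mirror_nth)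
  have sumQ: "Q \<epsilon> y + Q \<epsilon> (?R y) = (if y \<in> ball x \<epsilon> then (w x + w y) * J (norm (x - ?R y)) else E y)"
    if "\<epsilon> \<le> d" "y $ k < l" for \<epsilon> y
  proof -
    have "?R y \<notin> ball x \<epsilon>" using far[OF that(2)] that(1) by (simp add: dist_norm)
    then show ?thesis by (simp add: Q_def E_def w_def algebra_simps)
  qed
  have E: "E y \<le> 0" if "y $ k < l" "y \<noteq> x" for y
  proof -
    have "J (norm (x - ?R y)) \<le> J (norm (x - y))"
      using norm_diff_less_mirror[OF xl that(1)] that by (intro J_mono) auto
    then show ?thesis
      using min[OF that(1)] nonpos J_nonneg
      by (simp add: E_def mult_nonneg_nonneg mult_nonpos_nonneg order_trans[of _ 0])
  qed
  define \<epsilon>0 where "\<epsilon>0 = Min {1, r, d}"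
  have e0: "0 < \<epsilon>0" "\<epsilon>0 \<le> 1" "\<epsilon>0 \<le> r" "\<epsilon>0 \<le> d" using B d by (auto simp: \<epsilon>0_def)
  have BE: "indicator B y * E y = indicator B y * (indicator ?H y * (Q \<epsilon>0 y + Q \<epsilon>0 (?R y)))" for y
  proof (cases "y \<in> B")
    case True
    then have "y $ k < l" "y \<notin> ball x r" using B by blast+
    then show ?thesis using e0 sumQ[of \<epsilon>0 y] by simp
  qed simp
  have intB: "integrable lborel (\<lambda>y. indicator B y * E y)"
    unfolding BE using integrable_mult_indicator[OF _ Q2(3)[OF e0(1)], of B] B by simp
  then show ?int by (simp add: E_def)
  have "bounded (w ` cball x 1)"
    by (intro compact_imp_bounded compact_continuous_image continuous_on_subset[OF ud]) auto
  then obtain M where "\<forall>v\<in>w ` cball x 1. norm v \<le> M"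
    unfolding bounded_iff by blast
  then have M: "\<bar>w y\<bar> \<le> M" if "y \<in> cball x 1" for y using that by auto
  have M0: "0 \<le> M" using M[of x] by auto
  define c where "c = 2 * M * J d"
  have bound: "trunc u \<epsilon> (?R x) - trunc u \<epsilon> x
      \<le> (LINT y|lborel. indicator B y * E y) + c * (unit_ball_vol CARD('n) * \<epsilon> ^ CARD('n))"
    if e: "0 < \<epsilon>" "\<epsilon> < \<epsilon>0" for \<epsilon>
  proof -
    have bi: "integrable lborel (\<lambda>y :: real ^ 'n. c * indicator (ball x \<epsilon>) y)"
      using emeasure_lborel_ball_finite[of x \<epsilon>] by (intro integrable_mult_right integrable_real_indicator) auto
    have "trunc u \<epsilon> (?R x) - trunc u \<epsilon> x \<le> (LINT y|lborel. indicator ?H y * (Q \<epsilon> y + Q \<epsilon> (?R y)))"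
      using Q1(2)[OF e(1)] Q2(2)[OF e(1)] by simp
    also have "\<dots> \<le> (LINT y|lborel. indicator B y * E y + c * indicator (ball x \<epsilon>) y)"
    proof (intro integral_mono Q2(3)[OF e(1)] Bochner_Integration.integrable_add intB bi)
      fix y
      have c0: "0 \<le> c" using M0 J_nonneg by (simp add: c_def)
      show "indicator ?H y * (Q \<epsilon> y + Q \<epsilon> (?R y)) \<le> indicator B y * E y + c * indicator (ball x \<epsilon>) y"
      proof (cases "y $ k < l")
        case True
        show ?thesis
        proof (cases "y \<in> ball x \<epsilon>")
          case in_ball: True
          then have "y \<in> ball x r" using e e0 by simp
          then have yB: "y \<notin> B" using B(3) by blast
          have "w x + w y \<le> 2 * M" using M[of x] M[of y] in_ball e e0 by auto
          then have "(w x + w y) * J (norm (x - ?R y)) \<le> 2 * M * J (norm (x - ?R y))"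
            using J_nonneg by (rule mult_right_mono)
          also have "\<dots> \<le> c"
            unfolding c_def using far[OF True] d M0 by (intro mult_left_mono J_mono) auto
          finally show ?thesis using True in_ball yB sumQ[of \<epsilon> y] e e0 by simp
        next
          case False
          then have "y \<noteq> x" using e by auto
          then show ?thesis using True False sumQ[of \<epsilon> y] e e0 E[of y] by (auto simp: indicator_def)
        qed
      next
        case False
        then show ?thesis using B c0 by (auto simp: indicator_def)
      qed
    qed
    also have "\<dots> = (LINT y|lborel. indicator B y * E y) + c * (unit_ball_vol CARD('n) * \<epsilon> ^ CARD('n))"
      using intB bi e by (simp add: content_ball)
    finally show ?thesis .
  qed
  show ?le
    unfolding E_def[symmetric]
  proof (rule tendsto_le)
    show "((\<lambda>\<epsilon>. trunc u \<epsilon> (?R x) - trunc u \<epsilon> x) \<longlongrightarrow> P' - P) (at_right 0)"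
      by (intro tendsto_diff P P')
    have "((\<lambda>\<epsilon>. (LINT y|lborel. indicator B y * E y) + c * (unit_ball_vol CARD('n) * \<epsilon> ^ CARD('n)))
       \<longlongrightarrow> (LINT y|lborel. indicator B y * E y) + c * (unit_ball_vol CARD('n) * 0 ^ CARD('n))) (at_right 0)"
      by (intro tendsto_intros)
    then show "((\<lambda>\<epsilon>. (LINT y|lborel. indicator B y * E y) + c * (unit_ball_vol CARD('n) * \<epsilon> ^ CARD('n)))
       \<longlongrightarrow> (LINT y|lborel. indicator B y * E y)) (at_right 0)" by (simp add: power_0_left)
    show "eventually (\<lambda>\<epsilon>. trunc u \<epsilon> (?R x) - trunc u \<epsilon> x
      \<le> (LINT y|lborel. indicator B y * E y) + c * (unit_ball_vol CARD('n) * \<epsilon> ^ CARD('n))) (at_right 0)"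
      unfolding eventually_at_right_field using bound e0(1) by blast
  qed simp
qed

text \<open>
  At a zero of a nonnegative mirror difference only the second term of the comparison integrand
  remains, and it is strictly negative on a small ball around any point where the difference is positive.
\<close>

lemma mirror_strong_maximum:
  assumes u: "admissible u" and xl: "x $ k < l"
    and P: "((\<lambda>\<epsilon>. trunc u \<epsilon> x) \<longlongrightarrow> P) (at_right 0)"
    and P': "((\<lambda>\<epsilon>. trunc u \<epsilon> (mirror k l x)) \<longlongrightarrow> P') (at_right 0)"
    and nn: "\<And>y. y $ k < l \<Longrightarrow> 0 \<le> mirror_diff k l u y"
    and zero: "mirror_diff k l u x = 0"
    and y: "y $ k < l" "0 < mirror_diff k l u y"
  shows "P' < P"
proof -
  have ud: "continuous_on UNIV (mirror_diff k l u)"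
    using u unfolding mirror_diff_def[abs_def] admissible_def
    by (intro continuous_intros continuous_on_compose2[of UNIV u UNIV "mirror k l"]) auto
  have "open {z. z $ k < l \<and> 0 < mirror_diff k l u z}"
    by (intro open_Collect_conj open_Collect_less continuous_intros ud)
  then obtain \<rho> where \<rho>: "\<rho> > 0" "ball y \<rho> \<subseteq> {z. z $ k < l \<and> 0 < mirror_diff k l u z}"
    by (rule openE) (use y in auto)
  define B where "B = ball y (\<rho> / 2)"
  have Bsub: "z $ k < l" "0 < mirror_diff k l u z" if "z \<in> B" for z
    using that \<rho> by (auto simp: B_def subset_iff)
  have "x \<notin> ball y \<rho>" using \<rho> zero by auto
  then have xy: "\<rho> \<le> dist y x" by simp
  have "z \<notin> ball x (\<rho> / 2)" if "z \<in> B" for z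
    using that xy dist_triangle[of y x z] by (auto simp: B_def dist_commute)
  then have disj: "B \<inter> ball x (\<rho> / 2) = {}" by auto
  note cmp = mirror_comparison[OF u xl P P' _ _ _ _ disj, unfolded zero, simplified]
  have int: "integrable lborel (\<lambda>z. indicator B z * (mirror_diff k l u z * (J (norm (x - z)) - J (norm (x - mirror k l z)))))"
    and le: "P' - P \<le> - (LINT z|lborel. indicator B z * (mirror_diff k l u z * (J (norm (x - z)) - J (norm (x - mirror k l z)))))"
    using cmp nn Bsub(1) \<rho>(1) by (simp_all add: B_def subset_iff)
  have pos: "0 < mirror_diff k l u z * (J (norm (x - z)) - J (norm (x - mirror k l z)))" if "z \<in> B" for z
  proof -
    have "z \<noteq> x" using Bsub(2)[OF that] zero by auto
    then have "J (norm (x - mirror k l z)) < J (norm (x - z))"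
      using norm_diff_less_mirror[OF xl Bsub(1)[OF that]] by (intro J_strict) auto
    then show ?thesis using Bsub(2)[OF that] by simp
  qed
  have "emeasure lborel B \<noteq> 0"
    using \<rho>(1) unit_ball_vol_pos[of "real CARD('n)"] by (simp add: B_def emeasure_ball less_imp_neq[symmetric])
  then have "0 < (LINT z|lborel. indicator B z * (mirror_diff k l u z * (J (norm (x - z)) - J (norm (x - mirror k l z)))))"
    using pos by (intro lborel_integral_pos[where A = B] int) (auto simp: indicator_def B_def less_imp_le)
  then show ?thesis using le by simp
qed

text \<open>
  If the minimum point \<open>x\<close> has distance \<open>d\<close> to the plane, the mirror image of a ball of
  radius \<open>d / 4\<close> below \<open>x\<close> lies within \<open>3 * d\<close> of \<open>x\<close>. The first
  term of the comparison integrand on this ball contributes a multiple of \<open>w x * d ^ N * J (3 * d)\<close>,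
  whose coefficient exceeds any constant when \<open>d\<close> is small. The width \<open>\<delta>\<close> depends
  on the kernel only, not on \<open>u\<close> or on the plane; this uniformity makes the limit argument for
  the critical plane work without a boundary point lemma.
\<close>

lemma mirror_narrow_region:
  assumes C: "0 \<le> C"
  shows "\<exists>\<delta>>0. \<forall>u l x P P'. admissible u \<and> x $ k < l \<and> l - x $ k < \<delta> \<and>
      ((\<lambda>\<epsilon>. trunc u \<epsilon> x) \<longlongrightarrow> P) (at_right 0) \<and>
      ((\<lambda>\<epsilon>. trunc u \<epsilon> (mirror k l x)) \<longlongrightarrow> P') (at_right 0) \<and>
      (\<forall>y. y $ k < l \<longrightarrow> mirror_diff k l u x \<le> mirror_diff k l u y) \<and>
      mirror_diff k l u x \<le> 0 \<longrightarrow> P' - P \<le> C * mirror_diff k l u x"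
proof -
  let ?v = "unit_ball_vol CARD('n) / 4 ^ CARD('n)"
  have v: "0 < ?v" by simp
  obtain \<delta> where \<delta>: "0 < \<delta>" "\<And>d. 0 < d \<Longrightarrow> d < \<delta> \<Longrightarrow> C / (2 * ?v) \<le> d ^ CARD('n) * J (3 * d)"
    using J_singular[of "C / (2 * ?v)"] by blast
  show ?thesis
  proof (intro exI[of _ \<delta>] conjI \<delta>(1) allI impI, elim conjE)
    fix u l x P P'
    assume u: "admissible u" and xl: "x $ k < l" and near: "l - x $ k < \<delta>"
      and P: "((\<lambda>\<epsilon>. trunc u \<epsilon> x) \<longlongrightarrow> P) (at_right 0)"
      and P': "((\<lambda>\<epsilon>. trunc u \<epsilon> (mirror k l x)) \<longlongrightarrow> P') (at_right 0)"
      and "\<forall>y. y $ k < l \<longrightarrow> mirror_diff k l u x \<le> mirror_diff k l u y"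
      and nonpos: "mirror_diff k l u x \<le> 0"
    then have min: "\<And>y. y $ k < l \<Longrightarrow> mirror_diff k l u x \<le> mirror_diff k l u y" by blast
    define d where "d = l - x $ k"
    have d: "0 < d" "d < \<delta>" using xl near by (auto simp: d_def)
    define a where "a = x - (d / 2) *\<^sub>R axis k 1"
    define B where "B = ball a (d / 4)"
    have xa: "dist a x = d / 2" using d by (simp add: a_def dist_norm norm_axis_1)
    have near': "dist x y < d" "d / 4 \<le> dist x y" if "y \<in> B" for y
      using that xa dist_triangle[of x y a] dist_triangle[of a x y] d by (auto simp: B_def dist_commute)
    have half: "y $ k < l" if "y \<in> B" for y
    proof -
      have "\<bar>(x - y) $ k\<bar> < d"
        using component_le_norm_cart[of "x - y" k] near'(1)[OF that] by (simp add: dist_norm)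
      then show ?thesis by (simp add: d_def)
    qed
    have disj: "B \<inter> ball x (d / 4) = {}" using near'(2) by fastforce
    note cmp = mirror_comparison[OF u xl P P' min nonpos, of B "d / 4"]
    have Bb: "B \<in> sets borel" "B \<subseteq> {y. y $ k < l}" using half by (auto simp: B_def)
    have e1: "comparison_integrand u l x y \<le> 2 * mirror_diff k l u x * J (3 * d)" if "y \<in> B" for y
    proof -
      have ne: "y \<noteq> x" using near'(2)[OF that] d by auto
      have lt: "norm (x - y) < norm (x - mirror k l y)" using norm_diff_less_mirror[OF xl half[OF that]] .
      have "norm (x - mirror k l y) \<le> norm (x - mirror k l x) + norm (mirror k l x - mirror k l y)"
        using norm_triangle_ineq[of "x - mirror k l x" "mirror k l x - mirror k l y"] by simp
      also have "norm (x - mirror k l x) = 2 * d" using d by (simp add: mirror_def norm_axis_1 d_def)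
      finally have "norm (x - mirror k l y) \<le> 3 * d"
        using near'(1)[OF that] by (simp add: norm_mirror_diff_mirror dist_norm)
      then have J1: "J (3 * d) \<le> J (norm (x - mirror k l y))"
        using lt by (intro J_mono) (auto intro: le_less_trans[OF norm_ge_zero])
      have J2: "J (norm (x - mirror k l y)) \<le> J (norm (x - y))"
        using lt ne by (intro J_mono) auto
      have "0 \<le> (mirror_diff k l u y - mirror_diff k l u x) * (J (norm (x - y)) - J (norm (x - mirror k l y)))"
        using min[OF half[OF that]] J2 by simp
      moreover have "2 * mirror_diff k l u x * J (norm (x - mirror k l y)) \<le> 2 * mirror_diff k l u x * J (3 * d)"
        using J1 nonpos by (intro mult_left_mono_neg) auto
      ultimately show ?thesis by linarith
    qed
    have bi: "integrable lborel (\<lambda>y. 2 * mirror_diff k l u x * J (3 * d) * indicator B y)"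
      using emeasure_lborel_ball_finite[of a "d / 4"] unfolding B_def by (intro integrable_mult_right integrable_real_indicator) auto
    have "P' - P \<le> (LINT y|lborel. indicator B y * comparison_integrand u l x y)"
      using cmp(2) Bb disj d by simp
    also have "\<dots> \<le> (LINT y|lborel. 2 * mirror_diff k l u x * J (3 * d) * indicator B y)"
      using cmp(1) Bb disj d e1 by (intro integral_mono bi) (auto simp: indicator_def)
    also have "\<dots> = mirror_diff k l u x * (2 * ?v * (d ^ CARD('n) * J (3 * d)))"
      using d by (simp add: B_def content_ball power_divide)
    also have "\<dots> \<le> mirror_diff k l u x * C"
    proof (intro mult_left_mono_neg nonpos)
      show "C \<le> 2 * ?v * (d ^ CARD('n) * J (3 * d))"
        using \<delta>(2)[OF d] v by (simp only: pos_divide_le_eq[of "2 * ?v"] mult_pos_pos zero_less_numeral mult_ac)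
    qed
    finally show "P' - P \<le> C * mirror_diff k l u x" by (simp add: mult.commute)
  qed
qed

end

section \<open>Moving planes\<close>

lemma mirror_diff_continuous:
  assumes "continuous_on UNIV u"
  shows "continuous_on UNIV (\<lambda>p. mirror_diff k (fst p) u (snd p))"
  unfolding mirror_diff_def
  by (intro continuous_intros continuous_on_compose2[OF assms]) auto

context radial_levy_kernel begin

text \<open>
  Call \<open>l\<close> bad if the mirror difference \<open>w\<close> is negative somewhere below the plane at
  height \<open>l\<close>. Coercivity makes the part of \<open>\<Omega>\<close> below each plane bounded, so for
  bad \<open>l\<close> the difference has a negative minimum, and it is attained inside \<open>\<Omega>\<close>.
  If there were bad planes, take minimum points for bad heights tending to their infimum \<open>l0\<close>.
  The narrow region principle keeps these points at a fixed distance from their planes, so a limit point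
  lies strictly below the plane at \<open>l0\<close>. But \<open>l0\<close> itself is not bad, because badness is
  an open condition, and so \<open>w = 0\<close> at the limit point. This contradicts the strong
  maximum principle if the point is in \<open>\<Omega>\<close>; on the boundary it is
  impossible because \<open>u\<close> vanishes there and is positive at the mirror image.
\<close>

lemma moving_planes:
  fixes u P :: "real ^ 'n \<Rightarrow> real" and A b :: real
  assumes u: "admissible u"
    and up: "\<And>x y. x \<in> closure \<Omega> \<Longrightarrow> horiz k x = horiz k y \<Longrightarrow> x $ k < y $ k \<Longrightarrow> y \<in> \<Omega>"
    and bdd: "\<And>\<Lambda>. bounded (\<Omega> \<inter> {x. x $ k \<le> \<Lambda>})"
    and pos: "\<And>x. x \<in> \<Omega> \<Longrightarrow> 0 < u x" and zero: "\<And>x. x \<notin> \<Omega> \<Longrightarrow> u x = 0"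
    and P: "\<And>x. x \<in> \<Omega> \<Longrightarrow> ((\<lambda>\<epsilon>. trunc u \<epsilon> x) \<longlongrightarrow> P x) (at_right 0)"
    and eq: "\<And>x. x \<in> \<Omega> \<Longrightarrow> A * P x + b * u x = f x (u x)" and A: "0 < A" and b: "0 \<le> b"
    and mono: "\<And>t. nondecreasing_in_xN k (closure \<Omega>) (\<lambda>x. f x t)"
    and lip: "loc_lipschitz_in_t (closure \<Omega>) f"
  shows "strictly_increasing_in_xN k \<Omega> u"
proof -
  let ?w = "\<lambda>l. mirror_diff k l u"
  have ucont: "continuous_on UNIV u" using u by (simp add: admissible_def)
  note wcont = mirror_diff_continuous[OF ucont, of k]
  have wcont1: "continuous_on S (\<lambda>l. ?w l x)" and wcont2: "continuous_on T (?w l)" for S T l x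
    using continuous_on_compose2[OF wcont, of S "\<lambda>l. (l, x)"]
      continuous_on_compose2[OF wcont, of T "\<lambda>x. (l, x)"]
    by (simp_all add: continuous_on_Pair)
  have u_nonneg: "0 \<le> u x" for x using pos[of x] zero[of x] by (cases "x \<in> \<Omega>") auto
  have closure: "x \<in> closure \<Omega>" if "x \<in> \<Omega>" for x using that closure_subset by auto
  have refl: "mirror k l x \<in> \<Omega>" if "x \<in> closure \<Omega>" "x $ k < l" for x l
    using up[OF that(1), of "mirror k l x"] that(2) by (simp add: mirror_nth)
  have outside: "0 \<le> ?w l x" if "x \<notin> \<Omega>" for x l
    using zero[OF that] u_nonneg by (simp add: mirror_diff_def)
  have rhs: "f x (u (mirror k l x)) - f x (u x) \<le> A * (P (mirror k l x) - P x) + b * ?w l x"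
    if x: "x \<in> \<Omega>" "x $ k < l" for x l
  proof -
    have R: "mirror k l x \<in> \<Omega>" using refl closure x by blast
    have "f x (u (mirror k l x)) \<le> f (mirror k l x) (u (mirror k l x))"
      using mono[of "u (mirror k l x)"] closure[OF x(1)] closure[OF R] x(2)
      unfolding nondecreasing_in_xN_def by (auto simp: mirror_nth)
    then show ?thesis using eq[OF x(1)] eq[OF R] by (simp add: mirror_diff_def algebra_simps)
  qed
  have strong: "0 < ?w l x"
    if nn: "\<And>y. y $ k < l \<Longrightarrow> 0 \<le> ?w l y" and x: "x \<in> \<Omega>" "x $ k < l" for l x
  proof (rule ccontr)
    assume "\<not> 0 < ?w l x"
    with nn[OF x(2)] have w0: "?w l x = 0" by simp
    obtain c where c: "\<And>z. z \<in> \<Omega> \<Longrightarrow> z $ k \<le> l \<Longrightarrow> norm z \<le> c"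
      using bdd[of l] unfolding bounded_iff by blast
    \<comment> \<open>A point far below x is outside \<Omega> while its mirror image is above x, hence in \<Omega>; so the
      mirror difference does not vanish identically.\<close>
    define t where "t = \<bar>x $ k\<bar> + \<bar>c\<bar> + 1"
    define y where "y = x - t *\<^sub>R axis k 1"
    have yk: "y $ k = x $ k - t" by (simp add: y_def)
    have yl: "y $ k < l" using x by (simp add: yk t_def)
    have "y \<notin> \<Omega>"
    proof
      assume "y \<in> \<Omega>"
      then have "\<bar>y $ k\<bar> \<le> c" using c[of y] yl component_le_norm_cart[of y k] by simp
      then show False by (simp add: yk t_def)
    qed
    moreover have "mirror k l y \<in> \<Omega>"
    proof (rule up[OF closure[OF x(1)]])
      show "horiz k x = horiz k (mirror k l y)"
        by (simp add: vec_eq_iff horiz_def mirror_nth) (simp add: y_def axis_def)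
      show "x $ k < mirror k l y $ k" using x(2) by (simp add: mirror_nth yk t_def)
    qed
    ultimately have "0 < ?w l y" using pos zero by (simp add: mirror_diff_def)
    then have "P (mirror k l x) < P x"
      using mirror_strong_maximum[OF u x(2) P[OF x(1)] P nn w0 yl] refl[OF closure[OF x(1)] x(2)] by blast
    then have "A * (P (mirror k l x) - P x) < 0" using A by (simp add: mult_pos_neg)
    moreover have "u (mirror k l x) = u x" using w0 by (simp add: mirror_diff_def)
    ultimately show False using rhs[OF x] w0 by simp
  qed
  define Bad where "Bad = {l. \<exists>y. y $ k < l \<and> ?w l y < 0}"
  have minimizer: "\<exists>x\<in>\<Omega>. x $ k < l \<and> ?w l x < 0 \<and> (\<forall>y. y $ k < l \<longrightarrow> ?w l x \<le> ?w l y)"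
    if "l \<in> Bad" for l
  proof -
    obtain y where y: "y $ k < l" "?w l y < 0" using \<open>l \<in> Bad\<close> by (auto simp: Bad_def)
    let ?K = "closure (\<Omega> \<inter> {x. x $ k \<le> l})"
    have K: "z \<in> ?K" if "z \<in> \<Omega>" "z $ k < l" for z
      using that closure_subset[of "\<Omega> \<inter> {x. x $ k \<le> l}"] by auto
    have "closed {x :: real ^ 'n. x $ k \<le> l}" by (intro closed_Collect_le continuous_intros)
    then have Kl: "?K \<subseteq> {x. x $ k \<le> l}" by (intro closure_minimal) auto
    have yK: "y \<in> ?K" using y outside[of y l] by (intro K) force+
    have "\<exists>x\<in>?K. \<forall>z\<in>?K. ?w l x \<le> ?w l z"
      by (rule continuous_attains_inf) (use yK bdd wcont2 in auto)
    then obtain x where x: "x \<in> ?K" "\<And>z. z \<in> ?K \<Longrightarrow> ?w l x \<le> ?w l z" by blast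
    have w: "?w l x < 0" using x(2)[OF yK] y by simp
    then have "x \<in> \<Omega>" using outside[of x l] by force
    moreover have "x $ k \<noteq> l"
    proof
      assume "x $ k = l"
      then have "mirror k l x = x" by (simp add: vec_eq_iff mirror_nth)
      then show False using w by (simp add: mirror_diff_def)
    qed
    moreover have "x $ k \<le> l" using x(1) Kl by auto
    moreover have "?w l x \<le> ?w l z" if "z $ k < l" for z
      using x(2) K that w outside[of z l] by (cases "z \<in> \<Omega>") force+
    ultimately show ?thesis using w by force
  qed
  have "Bad = {}"
  proof (rule ccontr)
    assume ne: "Bad \<noteq> {}"
    obtain c where c: "\<And>z. z \<in> \<Omega> \<Longrightarrow> z $ k \<le> 0 \<Longrightarrow> norm z \<le> c"
      using bdd[of 0] unfolding bounded_iff by blast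
    have "- \<bar>c\<bar> \<le> l" if l: "l \<in> Bad" for l
    proof (cases "0 \<le> l")
      case False
      obtain x where "x \<in> \<Omega>" "x $ k < l" using minimizer[OF l] by blast
      then show ?thesis using c[of x] component_le_norm_cart[of x k] False by simp
    qed simp
    then have bb: "bdd_below Bad" by (rule bdd_belowI)
    define l0 where "l0 = Inf Bad"
    have "\<exists>l\<in>Bad. l < l0 + inverse (real (Suc n))" for n
      using cInf_less_iff[OF ne bb, of "l0 + inverse (real (Suc n))"] by (simp add: l0_def)
    then obtain ls where ls: "\<And>n. ls n \<in> Bad" "\<And>n. ls n < l0 + inverse (real (Suc n))" by metis
    have ls0: "l0 \<le> ls n" for n using ls(1) bb by (simp add: l0_def cInf_lower)
    have ls1: "ls n \<le> l0 + 1" for n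
    proof -
      have "inverse (real (Suc n)) \<le> 1" by (simp add: field_simps)
      then show ?thesis using ls(2)[of n] by linarith
    qed
    have lim_ls: "ls \<longlonglongrightarrow> l0"
    proof (rule tendsto_sandwich)
      show "eventually (\<lambda>n. l0 \<le> ls n) sequentially" using ls0 by simp
      show "eventually (\<lambda>n. ls n \<le> l0 + inverse (real (Suc n))) sequentially"
        using ls(2) by (intro always_eventually allI less_imp_le)
      show "(\<lambda>n. l0 + inverse (real (Suc n))) \<longlonglongrightarrow> l0"
        by (rule LIMSEQ_inverse_real_of_nat_add)
    qed simp
    obtain xs where xs: "\<And>n. xs n \<in> \<Omega>" "\<And>n. xs n $ k < ls n" "\<And>n. ?w (ls n) (xs n) < 0"
      "\<And>n y. y $ k < ls n \<Longrightarrow> ?w (ls n) (xs n) \<le> ?w (ls n) y"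
    proof -
      have "\<forall>n. \<exists>x. x \<in> \<Omega> \<and> x $ k < ls n \<and> ?w (ls n) x < 0 \<and> (\<forall>y. y $ k < ls n \<longrightarrow> ?w (ls n) x \<le> ?w (ls n) y)"
        using minimizer[OF ls(1)] by blast
      then show thesis unfolding choice_iff using that by blast
    qed
    let ?K = "closure (\<Omega> \<inter> {x. x $ k \<le> l0 + 1})"
    have K: "compact ?K" "?K \<subseteq> closure \<Omega>" using bdd by (auto intro!: closure_mono)
    have xK: "xs n \<in> ?K" for n
      using closure_subset[of "\<Omega> \<inter> {x. x $ k \<le> l0 + 1}"] xs(1,2)[of n] ls1[of n] by auto
    have "bounded (u ` (?K \<union> (\<lambda>p. mirror k (fst p) (snd p)) ` ({l0..l0 + 1} \<times> ?K)))"
      by (intro compact_imp_bounded compact_continuous_image continuous_on_subset[OF ucont]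
          compact_Un compact_Times K(1) compact_Icc continuous_intros) auto
    then obtain M where "\<forall>v\<in>u ` (?K \<union> (\<lambda>p. mirror k (fst p) (snd p)) ` ({l0..l0 + 1} \<times> ?K)). norm v \<le> M"
      unfolding bounded_iff by blast
    then have M: "\<bar>u x\<bar> \<le> M" "l0 \<le> l \<Longrightarrow> l \<le> l0 + 1 \<Longrightarrow> \<bar>u (mirror k l x)\<bar> \<le> M" if "x \<in> ?K" for x l
      using that by force+
    define M' where "M' = M + 1"
    have M': "0 < M'" using M(1)[OF xK[of 0]] by (simp add: M'_def)
    obtain C where C: "0 < C" "\<And>t \<tau> x. t \<in> {- M'..M'} \<Longrightarrow> \<tau> \<in> {- M'..M'} \<Longrightarrow> t \<noteq> \<tau> \<Longrightarrow> x \<in> ?K \<Longrightarrow>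
        \<bar>f x t - f x \<tau>\<bar> / \<bar>t - \<tau>\<bar> \<le> C"
      using lip[unfolded loc_lipschitz_in_t_def, rule_format, OF M' conjI[OF K]] by blast
    \<comment> \<open>Twice the Lipschitz constant leaves a strict inequality after the right-hand side is absorbed.\<close>
    have "0 \<le> 2 * C / A" using C(1) A by simp
    note narrow_ex = mirror_narrow_region[OF this]
    obtain \<delta> where \<delta>: "0 < \<delta>" and narrow:
      "\<forall>u l x P P'. admissible u \<and> x $ k < l \<and> l - x $ k < \<delta> \<and>
        ((\<lambda>\<epsilon>. trunc u \<epsilon> x) \<longlongrightarrow> P) (at_right 0) \<and>
        ((\<lambda>\<epsilon>. trunc u \<epsilon> (mirror k l x)) \<longlongrightarrow> P') (at_right 0) \<and>
        (\<forall>y. y $ k < l \<longrightarrow> mirror_diff k l u x \<le> mirror_diff k l u y) \<and>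
        mirror_diff k l u x \<le> 0 \<longrightarrow> P' - P \<le> (2 * C / A) * mirror_diff k l u x"
      using narrow_ex by (elim exE conjE) rule
    \<comment> \<open>Closer to the plane the operator would force the difference of the right-hand sides below what
      the Lipschitz condition permits.\<close>
    have gap: "\<delta> \<le> ls n - xs n $ k" for n
    proof (rule ccontr)
      assume near: "\<not> \<delta> \<le> ls n - xs n $ k"
      let ?x = "xs n" and ?l = "ls n"
      let ?W = "?w ?l ?x"
      have W: "?W < 0" by (rule xs(3))
      have "P (mirror k ?l ?x) - P ?x \<le> (2 * C / A) * ?W"
        using near W xs(2)[of n] refl[OF closure[OF xs(1)] xs(2)]
        by (intro narrow[rule_format] conjI allI impI u P xs(1,4)) auto
      then have "A * (P (mirror k ?l ?x) - P ?x) \<le> A * ((2 * C / A) * ?W)"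
        using A by (intro mult_left_mono) auto
      then have 1: "A * (P (mirror k ?l ?x) - P ?x) \<le> 2 * C * ?W" using A by simp
      have "u (mirror k ?l ?x) \<noteq> u ?x" using W by (simp add: mirror_diff_def)
      then have "\<bar>f ?x (u (mirror k ?l ?x)) - f ?x (u ?x)\<bar> / \<bar>u (mirror k ?l ?x) - u ?x\<bar> \<le> C"
        using M(1)[OF xK[of n]] M(2)[OF xK[of n], of ?l] ls0[of n] ls1[of n]
        by (intro C(2) xK) (auto simp: M'_def abs_le_iff)
      then have "\<bar>f ?x (u (mirror k ?l ?x)) - f ?x (u ?x)\<bar> \<le> C * \<bar>?W\<bar>"
        using W by (simp add: mirror_diff_def divide_le_eq)
      then have "C * ?W \<le> f ?x (u (mirror k ?l ?x)) - f ?x (u ?x)" using W by simp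
      then have "C * ?W \<le> 2 * C * ?W + b * ?W" using rhs[OF xs(1) xs(2), of n] 1 by linarith
      moreover have "C * ?W < 0" "b * ?W \<le> 0" using C(1) b W by (auto simp: mult_pos_neg mult_nonneg_nonpos)
      ultimately show False by linarith
    qed
    obtain x r where r: "strict_mono r" and x: "x \<in> ?K" "(xs \<circ> r) \<longlonglongrightarrow> x"
      using K(1)[unfolded compact_def, rule_format, of xs] xK by blast
    have lim_lr: "(\<lambda>n. ls (r n)) \<longlonglongrightarrow> l0"
      using LIMSEQ_subseq_LIMSEQ[OF lim_ls r] by (simp add: o_def)
    have lim_xr: "(\<lambda>n. xs (r n)) \<longlonglongrightarrow> x" using x(2) by (simp add: o_def)
    have "\<delta> \<le> l0 - x $ k"
      by (rule LIMSEQ_le_const[OF tendsto_diff[OF lim_lr tendsto_vec_nth[OF lim_xr]]]) (use gap in auto)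
    then have xl: "x $ k < l0" using \<delta> by simp
    have "(\<lambda>n. ?w (ls (r n)) (xs (r n))) \<longlonglongrightarrow> ?w l0 x"
      using continuous_on_tendsto_compose[OF wcont tendsto_Pair[OF lim_lr lim_xr]] by simp
    then have w_le: "?w l0 x \<le> 0"
      by (rule LIMSEQ_le_const2) (use xs(3) in \<open>auto intro: less_imp_le\<close>)
    have l0_good: "0 \<le> ?w l0 y" if y: "y $ k < l0" for y
    proof (rule ccontr)
      assume neg: "\<not> 0 \<le> ?w l0 y"
      have "open {l. y $ k < l \<and> ?w l y < 0}"
        by (intro open_Collect_conj open_Collect_less continuous_intros wcont1)
      then obtain \<rho> where \<rho>: "\<rho> > 0" "ball l0 \<rho> \<subseteq> {l. y $ k < l \<and> ?w l y < 0}"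
        by (rule openE) (use y neg in auto)
      have "l0 - \<rho> / 2 \<in> ball l0 \<rho>" using \<rho>(1) by (simp add: dist_real_def)
      \<comment> \<open>A negative value persists for slightly lower planes, against the choice of l0 as infimum.\<close>
      then have "l0 - \<rho> / 2 \<in> Bad" using \<rho>(2) unfolding Bad_def by blast
      then have "l0 \<le> l0 - \<rho> / 2" using bb by (simp add: l0_def cInf_lower)
      then show False using \<rho>(1) by simp
    qed
    show False
    proof (cases "x \<in> \<Omega>")
      case True
      then show False using strong[OF l0_good True xl] w_le by simp
    next
      case False
      have "mirror k l0 x \<in> \<Omega>" using refl x(1) K(2) xl by blast
      then show False using pos zero[OF False] w_le by (force simp: mirror_diff_def)
    qed
  qed
  then have good: "0 \<le> ?w l y" if "y $ k < l" for l y using that by (force simp: Bad_def)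
  show ?thesis
    unfolding strictly_increasing_in_xN_def
  proof (intro ballI impI)
    fix x y assume x: "x \<in> \<Omega>" and "y \<in> \<Omega>" and xy: "horiz k x = horiz k y \<and> x $ k < y $ k"
    let ?l = "(x $ k + y $ k) / 2"
    have "0 < ?w ?l x" using good x xy by (intro strong) auto
    then show "u x < u y" using horiz_eq_imp_mirror[of k x y] xy by (simp add: mirror_diff_def)
  qed
qed

end

section \<open>Coercive epigraphs and the Bessel kernel\<close>

lemma continuous_on_horiz: "continuous_on UNIV (horiz k)"
proof -
  have "horiz k = (\<lambda>x. x - (x $ k) *\<^sub>R axis k 1)"
    by (simp add: fun_eq_iff vec_eq_iff horiz_def axis_def)
  then show ?thesis by (simp add: continuous_intros)
qed

lemma coercive_epigraph_properties:
  assumes "coercive_epigraph k \<Omega>"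
  shows "open \<Omega>"
    and "\<And>x y. x \<in> closure \<Omega> \<Longrightarrow> horiz k x = horiz k y \<Longrightarrow> x $ k < y $ k \<Longrightarrow> y \<in> \<Omega>"
    and "bounded (\<Omega> \<inter> {x. x $ k \<le> \<Lambda>})"
proof -
  obtain \<phi> where \<phi>: "continuous_on (horiz_space k) \<phi>"
    and lim: "filterlim \<phi> at_top (inf at_infinity (principal (horiz_space k)))"
    and \<Omega>: "\<Omega> = {x. x $ k > \<phi> (horiz k x)}"
    using assms unfolding coercive_epigraph_def by blast
  have hs: "horiz k x \<in> horiz_space k" for x by (simp add: horiz_def horiz_space_def)
  have cont: "continuous_on UNIV (\<lambda>x. \<phi> (horiz k x))"
    using hs by (intro continuous_on_compose2[OF \<phi> continuous_on_horiz]) auto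
  show "open \<Omega>" unfolding \<Omega> by (intro open_Collect_less cont continuous_intros)
  have "closure \<Omega> \<subseteq> {x. \<phi> (horiz k x) \<le> x $ k}"
    unfolding \<Omega> by (intro closure_minimal closed_Collect_le cont continuous_intros) auto
  then show "y \<in> \<Omega>" if "x \<in> closure \<Omega>" "horiz k x = horiz k y" "x $ k < y $ k" for x y
    using that by (force simp: \<Omega>)
  have "eventually (\<lambda>x. \<Lambda> \<le> \<phi> x) (inf at_infinity (principal (horiz_space k)))"
    using lim by (simp add: filterlim_at_top)
  then obtain r where r: "\<And>x. r \<le> norm x \<Longrightarrow> x \<in> horiz_space k \<Longrightarrow> \<Lambda> \<le> \<phi> x"
    by (auto simp: eventually_inf_principal eventually_at_infinity)
  have "closed (horiz_space k)"
    unfolding horiz_space_def by (intro closed_Collect_eq continuous_intros)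
  then have "compact (horiz_space k \<inter> cball 0 r)" by (intro closed_Int_compact) auto
  then have "bounded (\<phi> ` (horiz_space k \<inter> cball 0 r))"
    by (intro compact_imp_bounded compact_continuous_image continuous_on_subset[OF \<phi>]) auto
  then obtain c where "\<forall>v\<in>\<phi> ` (horiz_space k \<inter> cball 0 r). norm v \<le> c"
    unfolding bounded_iff by blast
  then have c: "\<bar>\<phi> x\<bar> \<le> c" if "x \<in> horiz_space k" "norm x \<le> r" for x using that by auto
  show "bounded (\<Omega> \<inter> {x. x $ k \<le> \<Lambda>})"
    unfolding bounded_iff
  proof (intro exI ballI)
    fix x assume "x \<in> \<Omega> \<inter> {x. x $ k \<le> \<Lambda>}"
    then have x: "\<phi> (horiz k x) < x $ k" "x $ k \<le> \<Lambda>" by (auto simp: \<Omega>)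
    then have nr: "norm (horiz k x) \<le> r" using r[of "horiz k x"] hs by fastforce
    have "x = horiz k x + (x $ k) *\<^sub>R axis k 1" by (simp add: vec_eq_iff horiz_def axis_def)
    then have "norm x \<le> norm (horiz k x) + \<bar>x $ k\<bar>"
      using norm_triangle_ineq[of "horiz k x" "(x $ k) *\<^sub>R axis k 1"] by simp
    then show "norm x \<le> r + (\<bar>c\<bar> + \<bar>\<Lambda>\<bar>)" using nr x c[OF hs nr] by linarith
  qed
qed

text \<open>
  Up to a positive constant factor, the jump kernel of \<open>(-\<Delta> + m\<^sup>2)\<^sup>s\<close> for
  \<open>\<nu> = N / 2 + s\<close>.
\<close>

definition bessel_kernel :: "real \<Rightarrow> real \<Rightarrow> real \<Rightarrow> real" where
  "bessel_kernel m \<nu> r = bessel_K \<nu> (m * r) / r powr \<nu>"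

text \<open>
  The exponent \<open>p = N / 2 + 1\<close> in the upper bound for the Bessel function exceeds
  \<open>\<nu>\<close> because \<open>s < 1\<close>, and gives the kernel the bound \<open>r powr (- (N + 1 + s))\<close>
  with \<open>0 < 1 + s < 2\<close>. The lower bound makes \<open>d ^ N * J (3 * d)\<close> at least a
  multiple of \<open>d powr (- 2 * s)\<close> for small \<open>d\<close>, which is unbounded because \<open>s > 0\<close>.
\<close>

lemma radial_levy_kernel_bessel:
  assumes s: "0 < s" "s < 1" and m: "0 < m" and \<nu>: "\<nu> = real CARD('n::finite) / 2 + s"
  shows "radial_levy_kernel TYPE('n) (bessel_kernel m \<nu>)"
proof
  let ?N = "real CARD('n)"
  have \<nu>0: "0 < \<nu>" using s by (simp add: \<nu>)
  show meas: "bessel_kernel m \<nu> \<in> borel_measurable borel" unfolding bessel_kernel_def by measurable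
  show nonneg: "0 \<le> bessel_kernel m \<nu> r" for r by (simp add: bessel_kernel_def bessel_K_nonneg)
  show "bessel_kernel m \<nu> r' < bessel_kernel m \<nu> r" if "0 < r" "r < r'" for r r'
    unfolding bessel_kernel_def using that m \<nu>0
    by (intro frac_less bessel_K_nonneg bessel_K_strict_antimono powr_mono2) auto
  define p where "p = ?N / 2 + 1"
  define c where "c = (2 * p) powr p / (p - \<nu>) * m powr (- p)"
  have p: "\<nu> < p" using s by (simp add: \<nu> p_def)
  show "integrable lborel (\<lambda>z :: real ^ 'n. min 1 (norm z ^ 2) * bessel_kernel m \<nu> (norm z))"
  proof (rule integrable_levy_power[where b = "1 + s" and C = c, OF meas nonneg])
    fix r :: real assume r: "0 < r"
    have "bessel_kernel m \<nu> r \<le> ((2 * p) powr p / (p - \<nu>) * (m * r) powr (- p)) / r powr \<nu>"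
      unfolding bessel_kernel_def using r m \<nu>0 p by (intro divide_right_mono bessel_K_le_powr) auto
    also have "\<dots> = c * r powr (- (real DIM(real ^ 'n) + (1 + s)))"
    proof -
      have "(m * r) powr (- p) / r powr \<nu> = m powr (- p) * r powr (- p - \<nu>)"
        using r m by (simp add: powr_mult powr_diff)
      also have "- p - \<nu> = - (real DIM(real ^ 'n) + (1 + s))" by (simp add: p_def \<nu>)
      finally have "(m * r) powr (- p) / r powr \<nu> = m powr (- p) * r powr (- (real DIM(real ^ 'n) + (1 + s)))" .
      then show ?thesis by (simp only: c_def times_divide_eq_right[symmetric] mult.assoc)
    qed
    finally show "bessel_kernel m \<nu> r \<le> c * r powr (- (real DIM(real ^ 'n) + (1 + s)))" .
  qed (use s in auto)
  show "\<exists>\<delta>>0. \<forall>d. 0 < d \<and> d < \<delta> \<longrightarrow> C \<le> d ^ CARD('n) * bessel_kernel m \<nu> (3 * d)" for C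
  proof -
    define a where "a = exp (- 1 - \<nu>) / 2 * (3 * m) powr (- \<nu>) * 3 powr (- \<nu>)"
    have a: "0 < a" using m by (simp add: a_def)
    define \<delta> where "\<delta> = min (exp (- 1) / (3 * m)) ((a / (\<bar>C\<bar> + 1)) powr (1 / (2 * s)))"
    have "0 < \<delta>" using a m by (auto simp: \<delta>_def)
    moreover have "C \<le> d ^ CARD('n) * bessel_kernel m \<nu> (3 * d)" if d: "0 < d" "d < \<delta>" for d
    proof -
      have "m * (3 * d) \<le> exp (- 1)" using d m by (simp add: \<delta>_def pos_less_divide_eq mult_ac)
      then have K: "exp (- 1 - \<nu>) / 2 * (m * (3 * d)) powr (- \<nu>) \<le> bessel_K \<nu> (m * (3 * d))"
        using d m \<nu>0 by (intro bessel_K_ge_powr) auto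
      have "d powr (2 * s) \<le> ((a / (\<bar>C\<bar> + 1)) powr (1 / (2 * s))) powr (2 * s)"
        using d s by (intro powr_mono2) (auto simp: \<delta>_def)
      also have "\<dots> = a / (\<bar>C\<bar> + 1)" using s a by (simp add: powr_powr)
      finally have "\<bar>C\<bar> + 1 \<le> a / d powr (2 * s)" using d by (simp add: field_simps)
      then have "C \<le> a * d powr (- (2 * s))" by (simp add: powr_minus divide_inverse)
      also have "a * d powr (- (2 * s)) = d ^ CARD('n) * ((exp (- 1 - \<nu>) / 2 * (m * (3 * d)) powr (- \<nu>)) / (3 * d) powr \<nu>)"
      proof -
        have e1: "(m * (3 * d)) powr (- \<nu>) = (3 * m) powr (- \<nu>) * d powr (- \<nu>)"
          using d m by (simp add: powr_mult mult_ac)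
        have e2: "1 / (3 * d) powr \<nu> = 3 powr (- \<nu>) * d powr (- \<nu>)"
          using d by (simp add: powr_mult powr_minus field_simps)
        have e3: "d ^ CARD('n) = d powr ?N" using d by (simp add: powr_realpow)
        have e4: "d powr ?N * (d powr (- \<nu>) * d powr (- \<nu>)) = d powr (- (2 * s))"
          using d by (simp add: powr_add[symmetric] \<nu>)
        have "d ^ CARD('n) * ((exp (- 1 - \<nu>) / 2 * (m * (3 * d)) powr (- \<nu>)) / (3 * d) powr \<nu>)
            = d ^ CARD('n) * (exp (- 1 - \<nu>) / 2 * (m * (3 * d)) powr (- \<nu>) * (1 / (3 * d) powr \<nu>))"
          by simp
        also have "\<dots> = a * (d powr ?N * (d powr (- \<nu>) * d powr (- \<nu>)))"
          unfolding e1 e2 e3 a_def by (simp only: mult_ac)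
        finally show ?thesis by (simp only: e4)
      qed
      also have "\<dots> \<le> d ^ CARD('n) * bessel_kernel m \<nu> (3 * d)"
        unfolding bessel_kernel_def using d by (intro mult_left_mono divide_right_mono K) auto
      finally show ?thesis .
    qed
    ultimately show ?thesis by blast
  qed
qed

theorem theorem2p22:
  fixes k :: "'n::finite" and s m :: real
    and \<Omega> :: "(real ^ 'n) set"
    and u :: "real ^ 'n \<Rightarrow> real"
    and f :: "real ^ 'n \<Rightarrow> real \<Rightarrow> real"
  assumes "0 < s" and "s < 1" and "m > 0"
    and "coercive_epigraph k \<Omega>"
    and "u \<in> L_space s" and "u \<in> C11_loc \<Omega>" and "continuous_on (closure \<Omega>) u"
    and "tail_integrable m s u"
    and "\<forall>x\<in>\<Omega>. rel_frac_op m s u x = f x (u x)"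
    and "\<forall>x\<in>\<Omega>. u x > 0"
    and "\<forall>x\<in>- \<Omega>. u x = 0"
    and "continuous_on (closure \<Omega> \<times> UNIV) (\<lambda>(x, t). f x t)"
    and "\<forall>t. nondecreasing_in_xN k (closure \<Omega>) (\<lambda>x. f x t)"
    and "loc_lipschitz_in_t (closure \<Omega>) f"
  shows "strictly_increasing_in_xN k \<Omega> u"
proof -
  define \<nu> where "\<nu> = real CARD('n) / 2 + s"
  interpret radial_levy_kernel k "bessel_kernel m \<nu>"
    by (rule radial_levy_kernel_bessel) (use assms in \<open>auto simp: \<nu>_def\<close>)
  note epi = coercive_epigraph_properties[OF \<open>coercive_epigraph k \<Omega>\<close>]
  \<comment> \<open>The function vanishes outside the open set \<Omega>, hence also on its boundary, and is continuous everywhere.\<close>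
  have "continuous_on (closure \<Omega> \<union> - \<Omega>) (\<lambda>x. if x \<in> closure \<Omega> then u x else 0)"
  proof (rule continuous_on_cases)
    show "closed (- \<Omega>)" using epi(1) by (rule closed_Compl)
  qed (use assms in \<open>auto intro: continuous_on_const\<close>)
  moreover have "closure \<Omega> \<union> - \<Omega> = UNIV" using closure_subset by auto
  moreover have "(\<lambda>x. if x \<in> closure \<Omega> then u x else 0) = u"
  proof
    fix x
    show "(if x \<in> closure \<Omega> then u x else 0) = u x"
      using assms(11) closure_subset[of \<Omega>] by (cases "x \<in> \<Omega>") auto
  qed
  ultimately have ucont: "continuous_on UNIV u" by metis
  note [measurable] = borel_measurable_continuous_onI[OF ucont]
  have "integrable lborel (\<lambda>y. indicator (- ball x 1) y * (\<bar>u y\<bar> * bessel_kernel m \<nu> (norm (x - y))))" for x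
  proof -
    have m: "(\<lambda>y. indicator (- ball x 1) y * (\<bar>u y\<bar> * bessel_kernel m \<nu> (norm (x - y)))) \<in> borel_measurable lborel"
      by (intro borel_measurable_times borel_measurable_indicator) auto
    have "- ball x 1 = {y. 1 \<le> norm (y - x)}" by (auto simp: dist_norm norm_minus_commute)
    then have "integrable lebesgue (\<lambda>y. indicator (- ball x 1) y * (\<bar>u y\<bar> * bessel_kernel m \<nu> (norm (x - y))))"
      using \<open>tail_integrable m s u\<close>
      by (simp add: tail_integrable_def Let_def set_integrable_def bessel_kernel_def \<nu>_def)
    then show ?thesis by (rule integrable_completion[OF m, THEN iffD1])
  qed
  then have u: "admissible u" using ucont by (simp add: admissible_def)
  have "\<exists>P. \<forall>x\<in>\<Omega>. ((\<lambda>\<epsilon>. trunc u \<epsilon> x) \<longlongrightarrow> P x) (at_right 0)"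
    using trunc_converges[OF u epi(1) \<open>u \<in> C11_loc \<Omega>\<close>] by metis
  then obtain P where P: "\<And>x. x \<in> \<Omega> \<Longrightarrow> ((\<lambda>\<epsilon>. trunc u \<epsilon> x) \<longlongrightarrow> P x) (at_right 0)" by blast
  define A where "A = c_const CARD('n) s * m powr \<nu>"
  have "0 < Gamma (2 - s)" using \<open>s < 1\<close> by (intro Gamma_real_pos) simp
  then have A: "0 < A" using assms(1-3) by (simp add: A_def c_const_def)
  have op: "rel_frac_op m s u x = A * P x + m powr (2 * s) * u x" if x: "x \<in> \<Omega>" for x
  proof -
    let ?g = "\<lambda>y. (u x - u y) / norm (x - y) powr \<nu> * bessel_K \<nu> (m * norm (x - y))"
    have "(LINT y:- ball x \<epsilon>|lebesgue. ?g y) = trunc u \<epsilon> x" for \<epsilon>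
    proof -
      have m: "trunc_integrand u \<epsilon> x \<in> borel_measurable lborel"
        by (intro borel_measurable_times borel_measurable_indicator) auto
      have "(LINT y:- ball x \<epsilon>|lebesgue. ?g y) = (LINT y|lebesgue. trunc_integrand u \<epsilon> x y)"
        by (simp add: set_lebesgue_integral_def bessel_kernel_def)
      also have "\<dots> = trunc u \<epsilon> x" unfolding trunc_def by (rule integral_completion[OF m])
      finally show ?thesis .
    qed
    then have "pv_integral ?g x = P x"
      unfolding pv_integral_def using P[OF x] by (simp add: tendsto_Lim)
    then show ?thesis by (simp add: rel_frac_op_def Let_def A_def \<nu>_def)
  qed
  show ?thesis
  proof (rule moving_planes[OF u epi(2,3), where P = P and A = A and b = "m powr (2 * s)" and f = f])
    show "A * P x + m powr (2 * s) * u x = f x (u x)" if "x \<in> \<Omega>" for x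
      using op[OF that] assms(9) that by simp
  qed (use assms P A in auto)
qed

end
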